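(* The graph isomorphism problem on $\mathrm{Free}(H(1,0,2,0),K_5)$ is isomorphism-complete.
   Context: $\mathrm{Free}(H_1,H_2)$ is the class of graphs containing neither $H_1$ nor $H_2$ as an induced subgraph; $K_5$ is the complete graph on 5 vertices. For non-negative integers $a_t,\dots,a_0$ with $a_t>0$, $H(a_t,\dots,a_1,a_0)$ is the disjoint union of an independent set of size $a_0$ with the subdivided star obtained from a center vertex by attaching, for each $i$, $a_i$ internally disjoint paths of length $i$. Thus $H(1,0,2,0)$ is a center with two pendant leaves and one pendant path of length 3. Isomorphism-complete means polynomial-time equivalent to general graph isomorphism. *)

theory Defs
  imports "HOL-Computational_Algebra.Polynomial"
begin

record 'a sgraph =
  verts :: "'a set"
  edges :: "'a set set"

definition simple_graph :: "'a sgraph \<Rightarrow> bool" where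
  "simple_graph G \<longleftrightarrow>
     finite (verts G) \<and> (\<forall>e\<in>edges G. e \<subseteq> verts G \<and> card e = 2)"

definition graph_iso :: "'a sgraph \<Rightarrow> 'b sgraph \<Rightarrow> bool"  (infix \<open>\<simeq>\<close> 50) where
  "G \<simeq> H \<longleftrightarrow>
     (\<exists>f. bij_betw f (verts G) (verts H) \<and>
          (\<forall>u\<in>verts G. \<forall>v\<in>verts G. {u, v} \<in> edges G \<longleftrightarrow> {f u, f v} \<in> edges H))"

definition induced :: "'a sgraph \<Rightarrow> 'a set \<Rightarrow> 'a sgraph" where
  "induced G S = \<lparr>verts = S, edges = {e \<in> edges G. e \<subseteq> S}\<rparr>"

definition contains_induced :: "'a sgraph \<Rightarrow> 'b sgraph \<Rightarrow> bool" where
  "contains_induced G H \<longleftrightarrow> (\<exists>S \<subseteq> verts G. induced G S \<simeq> H)"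

definition Free :: "'b sgraph \<Rightarrow> 'c sgraph \<Rightarrow> 'a sgraph set" where
  "Free H1 H2 =
     {G. simple_graph G \<and> \<not> contains_induced G H1 \<and> \<not> contains_induced G H2}"

definition complete_graph :: "nat \<Rightarrow> nat sgraph" where
  "complete_graph n = \<lparr>verts = {..<n}, edges = {e. e \<subseteq> {..<n} \<and> card e = 2}\<rparr>"

text \<open>
  The list \<open>[a\<^sub>t, \<dots>, a\<^sub>1, a\<^sub>0]\<close> stands for the graph \<open>H(a\<^sub>t, \<dots>, a\<^sub>1, a\<^sub>0)\<close>, so
  \<open>a\<^sub>i = rev as ! i\<close>.  The vertex \<open>Leg i j k\<close> is the one at distance \<open>k\<close> from the center
  on the \<open>j\<close>-th of the \<open>a\<^sub>i\<close> attached paths of length \<open>i\<close>.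
\<close>

datatype star_vertex = Center | Isolated nat | Leg nat nat nat

definition sub_star :: "nat list \<Rightarrow> star_vertex sgraph" where
  "sub_star as =
     \<lparr>verts = {Center} \<union> {Isolated j | j. j < rev as ! 0} \<union>
        {Leg i j k | i j k. i < length as \<and> j < rev as ! i \<and> 1 \<le> k \<and> k \<le> i},
      edges = {{Center, Leg i j 1} | i j. 1 \<le> i \<and> i < length as \<and> j < rev as ! i} \<union>
        {{Leg i j k, Leg i j (k + 1)} | i j k.
           i < length as \<and> j < rev as ! i \<and> 1 \<le> k \<and> k + 1 \<le> i}\<rparr>"

text \<open>
  States are \<open>0, \<dots>, state_count M\<close>, where \<open>0\<close> is the start state and \<open>state_count M\<close> the
  halting state.  Tape symbols are \<open>0, \<dots>, symbol_count M - 1\<close>, where \<open>0\<close> is the blank and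
  the bits \<open>False\<close>, \<open>True\<close> are written as \<open>1\<close>, \<open>2\<close>.  A tape is infinite in both directions
  and comes with its head position.  Tape \<open>0\<close> initially holds the input; on halting, tape \<open>1\<close>
  holds exactly the output.
\<close>

record tm =
  tape_count :: nat
  state_count :: nat
  symbol_count :: nat
  trans :: "nat \<Rightarrow> nat list \<Rightarrow> nat \<times> (nat \<times> int) list"

definition valid_tm :: "tm \<Rightarrow> bool" where
  "valid_tm M \<longleftrightarrow> 2 \<le> tape_count M \<and> 3 \<le> symbol_count M \<and>
     (\<forall>q ss q' acts.
        q < state_count M \<and> length ss = tape_count M \<and> set ss \<subseteq> {..<symbol_count M} \<and>
        trans M q ss = (q', acts) \<longrightarrow>
        q' \<le> state_count M \<and> length acts = tape_count M \<and>
        set acts \<subseteq> {..<symbol_count M} \<times> {-1, 0, 1})"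

type_synonym tape = "(int \<Rightarrow> nat) \<times> int"
type_synonym config = "nat \<times> tape list"

definition scanned :: "tape \<Rightarrow> nat" where
  "scanned t = fst t (snd t)"

definition act :: "nat \<times> int \<Rightarrow> tape \<Rightarrow> tape" where
  "act a t = ((fst t)(snd t := fst a), snd t + snd a)"

definition step :: "tm \<Rightarrow> config \<Rightarrow> config" where
  "step M c =
     (if fst c < state_count M
      then let (q', acts) = trans M (fst c) (map scanned (snd c))
           in (q', map2 act acts (snd c))
      else c)"

definition written :: "bool list \<Rightarrow> int \<Rightarrow> nat" where
  "written x i =
     (if 0 \<le> i \<and> i < int (length x) then (if x ! nat i then 2 else 1) else 0)"

definition initial :: "tm \<Rightarrow> bool list \<Rightarrow> config" where
  "initial M x = (0, (written x, 0) # replicate (tape_count M - 1) (written [], 0))"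

text \<open>
  A halted configuration is a fixed point of \<open>step\<close>, so running for exactly \<open>t\<close> steps in
  \<open>outputs_within\<close> means halting after at most \<open>t\<close> steps.
\<close>

definition outputs_within :: "tm \<Rightarrow> bool list \<Rightarrow> nat \<Rightarrow> bool list \<Rightarrow> bool" where
  "outputs_within M x t y \<longleftrightarrow>
     (let c = (step M ^^ t) (initial M x)
      in fst c = state_count M \<and> fst (snd c ! 1) = written y)"

definition polytime_on :: "bool list set \<Rightarrow> (bool list \<Rightarrow> bool list) \<Rightarrow> bool" where
  "polytime_on D f \<longleftrightarrow>
     (\<exists>M (p :: nat poly). valid_tm M \<and>
        (\<forall>x\<in>D. outputs_within M x (poly p (length x)) (f x)))"

text \<open>
  A decision problem is a set of instances with a subset of yes-instances; nothing is required
  on strings that are not instances.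
\<close>

record problem =
  instances :: "bool list set"
  yes_instances :: "bool list set"

definition poly_reducible :: "problem \<Rightarrow> problem \<Rightarrow> bool"  (infix \<open>\<le>\<^sub>p\<close> 50) where
  "A \<le>\<^sub>p B \<longleftrightarrow>
     (\<exists>f. polytime_on (instances A) f \<and>
          (\<forall>x\<in>instances A. f x \<in> instances B \<and>
             (x \<in> yes_instances A \<longleftrightarrow> f x \<in> yes_instances B)))"

definition poly_equivalent :: "problem \<Rightarrow> problem \<Rightarrow> bool" where
  "poly_equivalent A B \<longleftrightarrow> A \<le>\<^sub>p B \<and> B \<le>\<^sub>p A"

definition standard_graph :: "nat sgraph \<Rightarrow> bool" where
  "standard_graph G \<longleftrightarrow> simple_graph G \<and> verts G = {..<card (verts G)}"

text \<open>
  The number \<open>n\<close> of vertices in unary, closed by a \<open>False\<close>, followed by the \<open>n \<times> n\<close>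
  adjacency matrix row by row.  The code is self-delimiting, so pairs are concatenated.
\<close>

definition encode_graph :: "nat sgraph \<Rightarrow> bool list" where
  "encode_graph G =
     (let n = card (verts G)
      in replicate n True @ [False] @ [{i, j} \<in> edges G. i \<leftarrow> [0..<n], j \<leftarrow> [0..<n]])"

definition GI_on :: "nat sgraph set \<Rightarrow> problem" where
  "GI_on C =
     \<lparr>instances = {encode_graph G @ encode_graph H | G H.
        standard_graph G \<and> standard_graph H \<and> G \<in> C \<and> H \<in> C},
      yes_instances = {encode_graph G @ encode_graph H | G H.
        standard_graph G \<and> standard_graph H \<and> G \<in> C \<and> H \<in> C \<and> G \<simeq> H}\<rparr>"

definition isomorphism_complete :: "nat sgraph set \<Rightarrow> bool" where
  "isomorphism_complete C \<longleftrightarrow> poly_equivalent (GI_on C) (GI_on {G. simple_graph G})"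

end

theory Submission
  imports Defs
begin

text \<open>
  A graph on vertices \<open>0, \<dots>, n - 1\<close> is turned into a graph with four independent parts: two copies
  of the vertex set (left and right) and two copies of the set of ordered pairs (left and right
  flags).  A left vertex is joined to its own left flags only, a right vertex to its own right flags
  only, and between any other two parts all edges are present except a partial matching: \<open>Left u\<close> misses
  \<open>Right u\<close>, and \<open>LFlag u v\<close> misses \<open>RFlag u v\<close> if \<open>u\<close> and \<open>v\<close> are adjacent.  Four independent parts
  exclude \<open>K\<^sub>5\<close>.  Arranged in the cycle left, left flags, right flags, right, only consecutive parts
  have non-edges, so the independent set of size four in \<open>H(1,0,2,0)\<close> lies in two consecutive parts;
  a few cases on the two remaining vertices exclude this graph.

  For \<open>n \<ge> 3\<close> the vertices of the two copies are those of large degree, they fall into the two sides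
  because two of them have a common neighbour in this set iff they are on the same side, and
  exchanging the sides is an automorphism.  An isomorphism can therefore be assumed to
  map left to left; the missing matchings then show that it acts in the same way on both sides and
  preserves adjacency.

  The transformation is computed by a four-tape machine.  With the vertices listed in the right
  order, each row of the new adjacency matrix is produced by two nested loops in which
  equality of indices is detected by a mark on a unary counter tape.
\<close>

section \<open>Structured programs for Turing machines\<close>

datatype prog =
    Do "nat list \<Rightarrow> (nat \<times> int) list"
  | Seq prog prog  (infixr \<open>;;\<close> 60)
  | While "nat list \<Rightarrow> bool" prog

text \<open>The index is the exact number of machine steps: a primitive costs one, and each round of
  a loop costs two more than its body, for the test and the jump back. A loop that never stops has
  no derivation.\<close>

inductive exec :: "prog \<Rightarrow> tape list \<Rightarrow> nat \<Rightarrow> tape list \<Rightarrow> bool" where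
  exec_Do: "exec (Do f) T 1 (map2 act (f (map scanned T)) T)"
| exec_Seq: "exec p T s T' \<Longrightarrow> exec q T' t T'' \<Longrightarrow> exec (p ;; q) T (s + t) T''"
| exec_While_False: "\<not> c (map scanned T) \<Longrightarrow> exec (While c p) T 1 T"
| exec_While_True: "c (map scanned T) \<Longrightarrow> exec p T s T' \<Longrightarrow> exec (While c p) T' t T'' \<Longrightarrow>
    exec (While c p) T (s + t + 2) T''"

definition stay :: "nat list \<Rightarrow> (nat \<times> int) list" where
  "stay = map (\<lambda>s. (s, 0))"

fun code_length :: "prog \<Rightarrow> nat" where
  "code_length (Do f) = 1"
| "code_length (p ;; q) = code_length p + code_length q"
| "code_length (While c p) = code_length p + 2"

text \<open>States are addresses of instructions. Code starting at address \<open>b\<close> exits to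
  the address just behind its last instruction, so sequencing is concatenation. A loop has a test in
  front of its body and a jump back behind it; both use \<open>stay\<close>, which leaves the tapes
  unchanged.\<close>

fun compile :: "prog \<Rightarrow> nat \<Rightarrow> (nat list \<Rightarrow> nat \<times> (nat \<times> int) list) list" where
  "compile (Do f) b = [\<lambda>ss. (b + 1, f ss)]"
| "compile (p ;; q) b = compile p b @ compile q (b + code_length p)"
| "compile (While c p) b =
     (\<lambda>ss. (if c ss then b + 1 else b + code_length p + 2, stay ss)) # compile p (b + 1) @
     [\<lambda>ss. (b, stay ss)]"

definition machine :: "nat \<Rightarrow> nat \<Rightarrow> prog \<Rightarrow> tm" where
  "machine k m p = \<lparr>tape_count = k, state_count = code_length p, symbol_count = m,
     trans = (\<lambda>q. compile p 0 ! q)\<rparr>"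

lemma machine_simps [simp]:
  "tape_count (machine k m p) = k" "state_count (machine k m p) = code_length p"
  "symbol_count (machine k m p) = m" "trans (machine k m p) = (!) (compile p 0)"
  by (simp_all add: machine_def)

fun well_formed :: "nat \<Rightarrow> nat \<Rightarrow> prog \<Rightarrow> bool" where
  "well_formed k m (Do f) \<longleftrightarrow> (\<forall>ss. length ss = k \<and> set ss \<subseteq> {..<m} \<longrightarrow>
     length (f ss) = k \<and> set (f ss) \<subseteq> {..<m} \<times> {-1, 0, 1})"
| "well_formed k m (p ;; q) \<longleftrightarrow> well_formed k m p \<and> well_formed k m q"
| "well_formed k m (While c p) \<longleftrightarrow> well_formed k m p"

lemma length_compile [simp]: "length (compile p b) = code_length p"
  by (induction p arbitrary: b) auto

text \<open>Jumps stay inside the block or go to its exit address, and for a whole program this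
  address is the halting state.\<close>

lemma compile_bounds:
  assumes "well_formed k m p" "i \<in> set (compile p b)" "length ss = k" "set ss \<subseteq> {..<m}"
    and "i ss = (q', acts)"
  shows "q' \<le> b + code_length p \<and> length acts = k \<and> set acts \<subseteq> {..<m} \<times> {-1, 0, 1}"
  using assms
proof (induction p arbitrary: b)
  case (Do f)
  then show ?case by auto
next
  case (Seq p q)
  show ?case
  proof (cases "i \<in> set (compile p b)")
    case True
    then show ?thesis using Seq.IH(1)[of b] Seq.prems by auto
  next
    case False
    then show ?thesis using Seq.IH(2)[of "b + code_length p"] Seq.prems by auto
  qed
next
  case (While c p)
  have st: "length (stay ss) = k \<and> set (stay ss) \<subseteq> {..<m} \<times> {-1, 0, 1}"
    using While.prems by (auto simp: stay_def)
  show ?case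
  proof (cases "i \<in> set (compile p (b + 1))")
    case True
    then show ?thesis using While.IH[of "b + 1"] While.prems by auto
  next
    case False
    then show ?thesis using While.prems st by (auto split: if_splits)
  qed
qed

lemma valid_machine:
  assumes "well_formed k m p" "2 \<le> k" "3 \<le> m"
  shows "valid_tm (machine k m p)"
  unfolding valid_tm_def
proof (intro conjI allI impI)
  fix q ss q' acts
  assume "q < state_count (machine k m p) \<and> length ss = tape_count (machine k m p) \<and>
    set ss \<subseteq> {..<symbol_count (machine k m p)} \<and> trans (machine k m p) q ss = (q', acts)"
  then have "q < code_length p" "length ss = k" "set ss \<subseteq> {..<m}" "(compile p 0 ! q) ss = (q', acts)"
    by auto
  then have "q' \<le> 0 + code_length p \<and> length acts = k \<and> set acts \<subseteq> {..<m} \<times> {-1, 0, 1}"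
    by (intro compile_bounds[OF assms(1), of "compile p 0 ! q"]) simp_all
  then show "q' \<le> state_count (machine k m p)" "length acts = tape_count (machine k m p)"
    "set acts \<subseteq> {..<symbol_count (machine k m p)} \<times> {-1, 0, 1}"
    by auto
qed (use assms in auto)

lemma act_stay: "map2 act (stay (map scanned T)) T = T"
  by (induction T) (auto simp: stay_def act_def scanned_def)

lemma step_nth:
  assumes "trans M = (!) code" "state_count M = length code" "code = pre @ i # post"
    and "i (map scanned T) = (q', acts)"
  shows "step M (length pre, T) = (q', map2 act acts T)"
  using assms by (simp add: step_def)

text \<open>The parts of a compound program start at later addresses, so the induction needs a block
  at an arbitrary place of the code, between \<open>pre\<close> and \<open>post\<close>.\<close>

lemma exec_compile:
  assumes "exec p T t T'" "trans M = (!) code" "state_count M = length code"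
    and "code = pre @ compile p (length pre) @ post"
  shows "(step M ^^ t) (length pre, T) = (length pre + code_length p, T')"
  using assms(1,4)
proof (induction arbitrary: pre post rule: exec.induct)
  case (exec_Do f T)
  then show ?case
    using step_nth[OF assms(2,3), of pre "\<lambda>ss. (length pre + 1, f ss)" post T] by simp
next
  case (exec_Seq p T s T' q t T'')
  have 1: "(step M ^^ s) (length pre, T) = (length pre + code_length p, T')"
    using exec_Seq.IH(1)[of pre "compile q (length pre + code_length p) @ post"] exec_Seq.prems by simp
  have 2: "(step M ^^ t) (length pre + code_length p, T') =
      (length pre + code_length p + code_length q, T'')"
    using exec_Seq.IH(2)[of "pre @ compile p (length pre)" post] exec_Seq.prems by simp
  show ?case
    by (subst add.commute) (simp add: funpow_add 1 2)
next
  case (exec_While_False c T p)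
  then show ?case
    using step_nth[OF assms(2,3) exec_While_False.prems[simplified], of T]
    by (simp add: act_stay)
next
  case (exec_While_True c T p s T' t T'')
  let ?test = "\<lambda>ss. (if c ss then length pre + 1 else length pre + code_length p + 2, stay ss)"
  let ?back = "\<lambda>ss. (length pre, stay ss)"
  have code: "code = pre @ ?test # compile p (length pre + 1) @ ?back # post"
    using exec_While_True.prems by simp
  have 1: "step M (length pre, T) = (length pre + 1, T)"
    using step_nth[OF assms(2,3) code, of T] exec_While_True.hyps(1) by (simp add: act_stay)
  have 2: "(step M ^^ s) (length pre + 1, T) = (length pre + 1 + code_length p, T')"
    using exec_While_True.IH(1)[of "pre @ [?test]" "?back # post"] code by simp
  have 3: "step M (length pre + 1 + code_length p, T') = (length pre, T')"
    using step_nth[OF assms(2,3), of "pre @ ?test # compile p (length pre + 1)" ?back post T'] code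
    by (simp add: act_stay)
  have 4: "(step M ^^ t) (length pre, T') = (length pre + code_length (While c p), T'')"
    using exec_While_True.IH(2)[OF exec_While_True.prems] .
  \<comment> \<open>One step for the test, \<open>s\<close> for the body, one for the jump back,
    then \<open>t\<close> for the rest of the loop.\<close>
  have "s + t + 2 = t + Suc (s + 1)" by simp
  then have "(step M ^^ (s + t + 2)) (length pre, T) =
      (step M ^^ t) (step M ((step M ^^ s) (step M (length pre, T))))"
    by (simp only: funpow_add funpow.simps o_apply One_nat_def id_apply)
  then show ?case
    by (simp only: 1 2 3 4)
qed

text \<open>Upper bounds instead of exact counts, so that running times can be rounded up after each
  construction.\<close>

definition runs :: "prog \<Rightarrow> tape list \<Rightarrow> nat \<Rightarrow> tape list \<Rightarrow> bool" where
  "runs p T t T' \<longleftrightarrow> (\<exists>s\<le>t. exec p T s T')"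

lemma step_halted: "fst c = state_count M \<Longrightarrow> (step M ^^ t) c = c"
  by (induction t) (auto simp: step_def)

lemma outputs_within_machine:
  assumes "runs p ((written x, 0) # replicate (k - 1) (written [], 0)) t T'"
    and "fst (T' ! 1) = written y" "t \<le> t'"
  shows "outputs_within (machine k m p) x t' y"
proof -
  obtain s where s: "s \<le> t" "exec p ((written x, 0) # replicate (k - 1) (written [], 0)) s T'"
    using assms(1) by (auto simp: runs_def)
  have "(step (machine k m p) ^^ s) (initial (machine k m p) x) = (0 + code_length p, T')"
    unfolding initial_def
    unfolding machine_simps
    by (rule exec_compile[OF s(2) machine_simps(4), of _ _ _ "[]" "[]", unfolded list.size machine_simps]) simp_all
  then have "(step (machine k m p) ^^ s) (initial (machine k m p) x) = (code_length p, T')"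
    by simp
  \<comment> \<open>A halted machine keeps its configuration, so the surplus steps change
    nothing.\<close>
  moreover have "(step (machine k m p) ^^ (t' - s)) (code_length p, T') = (code_length p, T')"
    by (intro step_halted) simp
  moreover have "step (machine k m p) ^^ t' =
      (step (machine k m p) ^^ (t' - s)) \<circ> (step (machine k m p) ^^ s)"
    using s(1) assms(3) by (simp flip: funpow_add)
  ultimately have "(step (machine k m p) ^^ t') (initial (machine k m p) x) = (code_length p, T')"
    by simp
  then show ?thesis
    using assms(2) unfolding outputs_within_def Let_def by simp
qed

lemma runs_mono: "runs p T s T' \<Longrightarrow> s \<le> t \<Longrightarrow> runs p T t T'"
  by (auto simp: runs_def intro: order_trans)

lemma runs_Do: "map2 act (f (map scanned T)) T = T' \<Longrightarrow> runs (Do f) T 1 T'"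
  using exec_Do by (auto simp: runs_def)

lemma runs_Seq: "runs p T s T' \<Longrightarrow> runs q T' t T'' \<Longrightarrow> runs (p ;; q) T (s + t) T''"
  unfolding runs_def by (meson add_mono exec_Seq)

text \<open>\<open>T i\<close> is the list of tapes after \<open>i\<close> rounds, and
  \<open>t\<close> bounds every single round; the final \<open>+ 1\<close> pays for the failing
  test.\<close>

lemma runs_While:
  assumes "\<And>i. i < m \<Longrightarrow> c (map scanned (T i)) \<and> runs p (T i) t (T (Suc i))"
    and "\<not> c (map scanned (T m))"
  shows "runs (While c p) (T 0) (m * (t + 2) + 1) (T m)"
  using assms
proof (induction m arbitrary: T)
  case 0
  then have "exec (While c p) (T 0) 1 (T 0)" by (intro exec_While_False)
  then show ?case by (auto simp: runs_def)
next
  case (Suc m)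
  have "runs (While c p) (T (Suc 0)) (m * (t + 2) + 1) (T (Suc m))"
    by (rule Suc.IH) (use Suc.prems in simp_all)
  then obtain s1 where s1: "s1 \<le> m * (t + 2) + 1" "exec (While c p) (T (Suc 0)) s1 (T (Suc m))"
    by (auto simp: runs_def)
  obtain s0 where s0: "s0 \<le> t" "exec p (T 0) s0 (T (Suc 0))" "c (map scanned (T 0))"
    using Suc.prems(1)[of 0] by (auto simp: runs_def)
  have "exec (While c p) (T 0) (s0 + s1 + 2) (T (Suc m))"
    using exec_While_True[OF s0(3,2) s1(2)] .
  then show ?case
    unfolding runs_def using s0(1) s1(1) by (intro exI[of _ "s0 + s1 + 2"] conjI) simp_all
qed

section \<open>The gadget\<close>

datatype gadget_vertex = Left nat | Right nat | LFlag nat nat | RFlag nat nat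

text \<open>A left flag hangs at its first coordinate and a right flag at its second, so the missing
  edge between \<open>LFlag u v\<close> and \<open>RFlag u v\<close> ties \<open>Left u\<close> to
  \<open>Right v\<close>. The last equation makes the four parts independent.\<close>

fun adj :: "(nat \<Rightarrow> nat \<Rightarrow> bool) \<Rightarrow> gadget_vertex \<Rightarrow> gadget_vertex \<Rightarrow> bool" where
  "adj E (Left u) (Right v) \<longleftrightarrow> u \<noteq> v"
| "adj E (Right v) (Left u) \<longleftrightarrow> u \<noteq> v"
| "adj E (Left u) (LFlag a b) \<longleftrightarrow> u = a"
| "adj E (LFlag a b) (Left u) \<longleftrightarrow> u = a"
| "adj E (Right v) (RFlag a b) \<longleftrightarrow> v = b"
| "adj E (RFlag a b) (Right v) \<longleftrightarrow> v = b"
| "adj E (LFlag a b) (RFlag c d) \<longleftrightarrow> \<not> (a = c \<and> b = d \<and> E a b)"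
| "adj E (RFlag c d) (LFlag a b) \<longleftrightarrow> \<not> (a = c \<and> b = d \<and> E a b)"
| "adj E (Left u) (RFlag a b) \<longleftrightarrow> True"
| "adj E (RFlag a b) (Left u) \<longleftrightarrow> True"
| "adj E (Right v) (LFlag a b) \<longleftrightarrow> True"
| "adj E (LFlag a b) (Right v) \<longleftrightarrow> True"
| "adj E _ _ \<longleftrightarrow> False"

text \<open>In this order a row of the adjacency matrix is printed by one loop over \<open>u\<close>
  followed by a nested loop over \<open>u\<close> and \<open>v\<close>.\<close>

definition vertex_list :: "nat \<Rightarrow> gadget_vertex list" where
  "vertex_list n = concat (map (\<lambda>u. [Left u, Right u]) [0..<n]) @
     concat (map (\<lambda>u. concat (map (\<lambda>v. [LFlag u v, RFlag u v]) [0..<n])) [0..<n])"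

lemma adj_commute: "adj E x y \<longleftrightarrow> adj E y x"
  by (cases x; cases y) auto

lemma adj_irrefl [simp]: "\<not> adj E x x"
  by (cases x) auto

text \<open>Here \<open>c\<close> is the center, \<open>a\<close> and \<open>b\<close> are the
  leaves, and \<open>p\<close>, \<open>q\<close>, \<open>r\<close> form the long path. The case
  splits begin with the independent set \<open>a\<close>, \<open>b\<close>, \<open>p\<close>,
  \<open>r\<close>, whose placements in the parts are restricted by the non-edges; \<open>q\<close>
  and \<open>c\<close> come last.\<close>

lemma no_star:
  assumes "adj E c a" "adj E c b" "adj E c p" "adj E p q" "adj E q r"
    "\<not> adj E a b" "\<not> adj E a p" "\<not> adj E a q" "\<not> adj E a r" "\<not> adj E b p" "\<not> adj E b q" "\<not> adj E b r"
    "\<not> adj E c q" "\<not> adj E c r" "\<not> adj E p r" "distinct [c,a,b,p,q,r]"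
  shows False
  by (insert assms)
    (cases a; cases b; simp?; cases p; simp?; cases r; simp?; cases q; simp?; cases c; simp?)

section \<open>Programs on counter tapes\<close>

text \<open>The head is on the first blank behind the output, ready for the next bit.\<close>

definition output_tape :: "bool list \<Rightarrow> tape" where
  "output_tape ys = (written ys, int (length ys))"

text \<open>
  \<open>counter n m h\<close> holds \<open>n\<close> in unary, with symbol \<open>2\<close> at cell \<open>m\<close> and \<open>1\<close> elsewhere; there is no mark
  if \<open>m\<close> is not in the range, and \<open>-1\<close> is used for this.  The head position \<open>h\<close> is the loop variable.
\<close>

definition counter :: "nat \<Rightarrow> int \<Rightarrow> int \<Rightarrow> tape" where
  "counter n m h = ((\<lambda>i. if 0 \<le> i \<and> i < int n then if i = m then 2 else 1 else 0), h)"

definition conf :: "(int \<Rightarrow> nat) \<Rightarrow> int \<Rightarrow> bool list \<Rightarrow> tape \<Rightarrow> tape \<Rightarrow> tape list" where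
  "conf X h ys u v = [(X, h), output_tape ys, u, v]"

definition move :: "nat \<Rightarrow> int \<Rightarrow> prog" where
  "move i d = Do (\<lambda>ss. (stay ss)[i := (ss ! i, d)])"

definition put :: "nat \<Rightarrow> nat \<Rightarrow> int \<Rightarrow> prog" where
  "put i a d = Do (\<lambda>ss. (stay ss)[i := (a, d)])"

definition emit :: "(nat list \<Rightarrow> bool) \<Rightarrow> prog" where
  "emit g = Do (\<lambda>ss. (stay ss)[1 := (if g ss then 2 else 1, 1)])"

text \<open>The head may be on the blank behind the counter, where the loop would stop at once;
  hence the initial move to the left. The loop ends on the blank at cell \<open>-1\<close>.\<close>

definition rewind :: "nat \<Rightarrow> prog" where
  "rewind i = move i (-1) ;; While (\<lambda>ss. ss ! i \<noteq> 0) (move i (-1)) ;; move i 1"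

definition find_mark :: "nat \<Rightarrow> prog" where
  "find_mark i = While (\<lambda>ss. ss ! i \<noteq> 2) (move i 1)"

text \<open>Erasing backwards restores a blank tape with its head at cell 0, as the next graph has
  to find it.\<close>

definition clear :: "nat \<Rightarrow> prog" where
  "clear i = While (\<lambda>ss. ss ! i \<noteq> 0) (move i 1) ;; move i (-1) ;;
     While (\<lambda>ss. ss ! i \<noteq> 0) (put i 0 (-1)) ;; move i 1"

lemma written_snoc: "written (ys @ [b]) = (written ys)(int (length ys) := if b then 2 else 1)"
  by (rule ext) (auto simp: written_def nth_append nat_less_iff)

lemma scanned_output_tape [simp]: "scanned (output_tape ys) = 0"
  by (simp add: scanned_def output_tape_def written_def)

lemma act_output_tape [simp]: "act (if b then 2 else 1, 1) (output_tape ys) = output_tape (ys @ [b])"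
  by (simp add: act_def output_tape_def written_snoc)

lemma scanned_counter:
  "scanned (counter n m h) = (if 0 \<le> h \<and> h < int n then if h = m then 2 else 1 else 0)"
  by (simp add: scanned_def counter_def)

lemma act_scanned: "act (scanned t, d) t = (fst t, snd t + d)"
  by (simp add: act_def scanned_def)

lemma act_counter_move [simp]: "act (scanned (counter n m h), d) (counter n m h) = counter n m (h + d)"
  by (simp add: act_scanned) (simp add: counter_def)

lemma act_counter_mark: "0 \<le> h \<Longrightarrow> h < int n \<Longrightarrow> act (2, d) (counter n (-1) h) = counter n h (h + d)"
  by (auto simp: act_def counter_def fun_eq_iff)

lemma act_counter_unmark: "0 \<le> h \<Longrightarrow> h < int n \<Longrightarrow> act (1, d) (counter n h h) = counter n (-1) (h + d)"
  by (auto simp: act_def counter_def fun_eq_iff)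

lemma act_counter_extend: "act (1, d) (counter n (-1) (int n)) = counter (Suc n) (-1) (int n + d)"
  by (auto simp: act_def counter_def fun_eq_iff)

lemma act_counter_shrink: "act (0, d) (counter (Suc n) (-1) (int n)) = counter n (-1) (int n + d)"
  by (auto simp: act_def counter_def fun_eq_iff)

text \<open>Writing back the scanned symbol without moving changes nothing, so only tape
  \<open>i\<close> is affected.\<close>

lemma map2_act_stay_update:
  "map2 act ((stay (map scanned T))[i := a]) T = (if i < length T then T[i := act a (T ! i)] else T)"
proof (rule nth_equalityI)
  fix j assume "j < length (map2 act ((stay (map scanned T))[i := a]) T)"
  then have j: "j < length T" by simp
  then have "act (scanned (T ! j), 0) (T ! j) = T ! j" by (simp add: act_scanned)
  with j show "map2 act ((stay (map scanned T))[i := a]) T ! j =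
      (if i < length T then T[i := act a (T ! i)] else T) ! j"
    by (auto simp: stay_def nth_list_update)
qed (simp add: stay_def)

lemma runs_move:
  "i < length T \<Longrightarrow> T ! i = counter n m h \<Longrightarrow> runs (move i d) T 1 (T[i := counter n m (h + d)])"
  unfolding move_def by (rule runs_Do) (simp add: map2_act_stay_update)

lemma runs_put:
  "i < length T \<Longrightarrow> runs (put i a d) T 1 (T[i := act (a, d) (T ! i)])"
  unfolding put_def by (rule runs_Do) (simp add: map2_act_stay_update)

lemma runs_move_input: "runs (move 0 d) (conf X h ys u v) 1 (conf X (h + d) ys u v)"
  unfolding move_def by (rule runs_Do) (simp only: map2_act_stay_update, simp add: conf_def act_scanned)

lemma runs_emit:
  "g [X h, 0, scanned u, scanned v] = b \<Longrightarrow> runs (emit g) (conf X h ys u v) 1 (conf X h (ys @ [b]) u v)"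
  unfolding emit_def
  by (rule runs_Do) (simp only: map2_act_stay_update, simp add: conf_def scanned_def[of "(X, h)"])

lemma runs_rewind:
  assumes "i < length T" "T ! i = counter n m (int k)" "k \<le> n"
  shows "runs (rewind i) T (6 * Suc n) (T[i := counter n m 0])"
proof -
  \<comment> \<open>The state after the initial move and \<open>j\<close> rounds; for
    \<open>j = k\<close> the head is at \<open>-1\<close>.\<close>
  define S where "S j = T[i := counter n m (int k - 1 - int j)]" for j
  have 1: "runs (move i (-1)) T 1 (S 0)"
    unfolding S_def using runs_move[OF assms(1,2), of "-1"] by simp
  have 2: "runs (While (\<lambda>ss. ss ! i \<noteq> 0) (move i (-1))) (S 0) (k * (1 + 2) + 1) (S k)"
  proof (rule runs_While)
    fix j assume "j < k"
    then show "map scanned (S j) ! i \<noteq> 0 \<and> runs (move i (-1)) (S j) 1 (S (Suc j))"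
      using assms runs_move[of i "S j" n m "int k - 1 - int j" "-1"]
      by (auto simp: S_def scanned_counter algebra_simps)
  qed (use assms in \<open>simp add: S_def scanned_counter\<close>)
  have 3: "runs (move i 1) (S k) 1 (T[i := counter n m 0])"
    using runs_move[of i "S k" n m "-1" 1] assms by (simp add: S_def)
  show ?thesis
    unfolding rewind_def
    by (rule runs_mono[OF runs_Seq[OF 1 runs_Seq[OF 2 3]]]) (use assms(3) in simp)
qed

lemma runs_find_mark:
  assumes "i < length T" "T ! i = counter n (int a) 0" "a < n"
  shows "runs (find_mark i) T (6 * Suc n) (T[i := counter n (int a) (int a)])"
proof -
  define S where "S j = T[i := counter n (int a) (int j)]" for j
  have "runs (While (\<lambda>ss. ss ! i \<noteq> 2) (move i 1)) (S 0) (a * (1 + 2) + 1) (S a)"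
  proof (rule runs_While)
    fix j assume "j < a"
    then show "map scanned (S j) ! i \<noteq> 2 \<and> runs (move i 1) (S j) 1 (S (Suc j))"
      using assms runs_move[of i "S j" n "int a" "int j" 1]
      by (auto simp: S_def scanned_counter algebra_simps)
  qed (use assms in \<open>simp add: S_def scanned_counter\<close>)
  moreover have "S 0 = T" using assms(2) by (metis S_def list_update_id of_nat_0)
  ultimately have "runs (find_mark i) T (a * (1 + 2) + 1) (S a)" by (simp add: find_mark_def)
  then show ?thesis unfolding S_def by (rule runs_mono) (use assms(3) in simp)
qed

lemma runs_clear:
  assumes "i < length T" "T ! i = counter n (-1) 0"
  shows "runs (clear i) T (6 * Suc n) (T[i := counter 0 (-1) 0])"
proof -
  define S where "S j = T[i := counter n (-1) (int j)]" for j
  \<comment> \<open>The erasing phase: the last \<open>j\<close> cells are blank already, and the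
    head is just to their left.\<close>
  define R where "R j = T[i := counter (n - j) (-1) (int n - int j - 1)]" for j
  have "runs (While (\<lambda>ss. ss ! i \<noteq> 0) (move i 1)) (S 0) (n * (1 + 2) + 1) (S n)"
  proof (rule runs_While)
    fix j assume "j < n"
    then show "map scanned (S j) ! i \<noteq> 0 \<and> runs (move i 1) (S j) 1 (S (Suc j))"
      using assms runs_move[of i "S j" n "-1" "int j" 1]
      by (auto simp: S_def scanned_counter algebra_simps)
  qed (use assms in \<open>simp add: S_def scanned_counter\<close>)
  moreover have "S 0 = T" using assms(2) by (metis S_def list_update_id of_nat_0)
  ultimately have 1: "runs (While (\<lambda>ss. ss ! i \<noteq> 0) (move i 1)) T (n * (1 + 2) + 1) (S n)" by simp
  have 2: "runs (move i (-1)) (S n) 1 (R 0)"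
    using runs_move[of i "S n" n "-1" "int n" "-1"] assms by (simp add: S_def R_def)
  have 3: "runs (While (\<lambda>ss. ss ! i \<noteq> 0) (put i 0 (-1))) (R 0) (n * (1 + 2) + 1) (R n)"
  proof (rule runs_While)
    fix j assume j: "j < n"
    then obtain k where k: "n - j = Suc k" "int n - int j - 1 = int k" "n - Suc j = k" "int n - int (Suc j) - 1 = int k - 1"
      using that[of "n - Suc j"] by auto
    then show "map scanned (R j) ! i \<noteq> 0 \<and> runs (put i 0 (-1)) (R j) 1 (R (Suc j))"
      using assms runs_put[of i "R j" 0 "-1"]
      by (simp add: R_def k scanned_counter act_counter_shrink del: of_nat_Suc)
  qed (use assms in \<open>simp add: R_def scanned_counter\<close>)
  have 4: "runs (move i 1) (R n) 1 (T[i := counter 0 (-1) 0])"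
    using runs_move[of i "R n" 0 "-1" "-1" 1] assms by (simp add: R_def)
  show ?thesis
    unfolding clear_def
    by (rule runs_mono[OF runs_Seq[OF 1 runs_Seq[OF 2 runs_Seq[OF 3 4]]]]) simp
qed

lemma runs_conf2:
  assumes "runs p (conf X h ys u v) t ((conf X h ys u v)[2 := u'])"
  shows "runs p (conf X h ys u v) t (conf X h ys u' v)"
  using assms by (simp add: conf_def)

lemma runs_conf3:
  assumes "runs p (conf X h ys u v) t ((conf X h ys u v)[3 := v'])"
  shows "runs p (conf X h ys u v) t (conf X h ys u v')"
  using assms by (simp add: conf_def eval_nat_numeral)

lemma length_conf [simp]: "length (conf X h ys u v) = 4"
  and nth_conf [simp]: "conf X h ys u v ! 2 = u" "conf X h ys u v ! 3 = v" "conf X h ys u v ! 1 = output_tape ys"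
  by (simp_all add: conf_def)

lemma runs_move2:
  "runs (move 2 d) (conf X h ys (counter n m k) v) 1 (conf X h ys (counter n m (k + d)) v)"
  by (rule runs_conf2[OF runs_move]) simp_all

lemma runs_move3:
  "runs (move 3 d) (conf X h ys u (counter n m k)) 1 (conf X h ys u (counter n m (k + d)))"
  by (rule runs_conf3[OF runs_move]) simp_all

lemma runs_put2:
  "act (a, d) u = u' \<Longrightarrow> runs (put 2 a d) (conf X h ys u v) 1 (conf X h ys u' v)"
  by (rule runs_conf2) (use runs_put[of 2 "conf X h ys u v" a d] in simp)

lemma runs_put3:
  "act (a, d) v = v' \<Longrightarrow> runs (put 3 a d) (conf X h ys u v) 1 (conf X h ys u v')"
  by (rule runs_conf3) (use runs_put[of 3 "conf X h ys u v" a d] in simp)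

lemma runs_rewind2:
  "0 \<le> k \<Longrightarrow> k \<le> int n \<Longrightarrow>
    runs (rewind 2) (conf X h ys (counter n m k) v) (6 * Suc n) (conf X h ys (counter n m 0) v)"
  by (rule runs_conf2[OF runs_rewind[where k = "nat k"]]) simp_all

lemma runs_rewind3:
  "0 \<le> k \<Longrightarrow> k \<le> int n \<Longrightarrow>
    runs (rewind 3) (conf X h ys u (counter n m k)) (6 * Suc n) (conf X h ys u (counter n m 0))"
  by (rule runs_conf3[OF runs_rewind[where k = "nat k"]]) simp_all

lemma runs_find_mark2:
  "a < n \<Longrightarrow> runs (find_mark 2) (conf X h ys (counter n (int a) 0) v) (6 * Suc n)
    (conf X h ys (counter n (int a) (int a)) v)"
  by (rule runs_conf2[OF runs_find_mark]) simp_all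

lemma runs_find_mark3:
  "a < n \<Longrightarrow> runs (find_mark 3) (conf X h ys u (counter n (int a) 0)) (6 * Suc n)
    (conf X h ys u (counter n (int a) (int a)))"
  by (rule runs_conf3[OF runs_find_mark]) simp_all

lemma runs_clear2:
  "runs (clear 2) (conf X h ys (counter n (-1) 0) v) (6 * Suc n) (conf X h ys (counter 0 (-1) 0) v)"
  by (rule runs_conf2[OF runs_clear]) simp_all

lemma runs_clear3:
  "runs (clear 3) (conf X h ys u (counter n (-1) 0)) (6 * Suc n) (conf X h ys u (counter 0 (-1) 0))"
  by (rule runs_conf3[OF runs_clear]) simp_all

text \<open>\<open>g\<close> receives the scanned input bit and, for each counter, whether its head
  is on the mark, that is, whether the current column index equals the row index stored
  there.\<close>

definition scan_bit :: "(bool \<Rightarrow> bool \<Rightarrow> bool \<Rightarrow> bool) \<Rightarrow> nat list \<Rightarrow> bool" where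
  "scan_bit g ss = g (ss ! 0 = 2) (ss ! 2 = 2) (ss ! 3 = 2)"

text \<open>
  The arguments give the bits in the columns \<open>Left\<close>, \<open>Right\<close>, \<open>LFlag\<close>, \<open>RFlag\<close>.  In the first loop the
  heads of both counters move together, so that one column index is compared with both marks.
\<close>

definition row ::
  "(bool \<Rightarrow> bool \<Rightarrow> bool \<Rightarrow> bool) \<Rightarrow> (bool \<Rightarrow> bool \<Rightarrow> bool \<Rightarrow> bool) \<Rightarrow>
   (bool \<Rightarrow> bool \<Rightarrow> bool \<Rightarrow> bool) \<Rightarrow> (bool \<Rightarrow> bool \<Rightarrow> bool \<Rightarrow> bool) \<Rightarrow> prog" where
  "row gA gB gF gG =
     While (\<lambda>ss. ss ! 3 \<noteq> 0) (emit (scan_bit gA) ;; emit (scan_bit gB) ;; move 2 1 ;; move 3 1) ;;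
     rewind 2 ;; rewind 3 ;;
     While (\<lambda>ss. ss ! 2 \<noteq> 0)
       (While (\<lambda>ss. ss ! 3 \<noteq> 0) (emit (scan_bit gF) ;; emit (scan_bit gG) ;; move 3 1) ;;
        rewind 3 ;; move 2 1) ;;
     rewind 2"

lemma runs_emit_scan_bit:
  "g (X h = 2) (scanned u = 2) (scanned v = 2) = b \<Longrightarrow>
    runs (emit (scan_bit g)) (conf X h ys u v) 1 (conf X h (ys @ [b]) u v)"
  by (rule runs_emit) (simp add: scan_bit_def)

lemma scanned_conf [simp]:
  "map scanned (conf X h ys u v) ! 0 = X h"
  "map scanned (conf X h ys u v) ! 2 = scanned u"
  "map scanned (conf X h ys u v) ! 3 = scanned v"
  by (simp_all add: conf_def scanned_def)

lemma scanned_counter_mark: "i < n \<Longrightarrow> scanned (counter n a (int i)) = 2 \<longleftrightarrow> int i = a"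
  and scanned_counter_nonzero: "0 < scanned (counter n a (int i)) \<longleftrightarrow> i < n"
  by (auto simp: scanned_counter)

text \<open>\<open>col\<close> is the desired row as a function of the column vertex; the hypotheses
  say that it can be computed from the input bit and comparisons with the marks \<open>a\<close> and
  \<open>b\<close>. All heads except that of the output end where they started, so rows can be
  chained.\<close>

lemma runs_row:
  assumes "\<And>i. i < n \<Longrightarrow> gA (X h = 2) (int i = a) (int i = b) = col (Left i)"
    and "\<And>i. i < n \<Longrightarrow> gB (X h = 2) (int i = a) (int i = b) = col (Right i)"
    and "\<And>i j. i < n \<Longrightarrow> j < n \<Longrightarrow> gF (X h = 2) (int i = a) (int j = b) = col (LFlag i j)"
    and "\<And>i j. i < n \<Longrightarrow> j < n \<Longrightarrow> gG (X h = 2) (int i = a) (int j = b) = col (RFlag i j)"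
  shows "runs (row gA gB gF gG) (conf X h ys (counter n a 0) (counter n b 0)) (25 * Suc n ^ 2)
    (conf X h (ys @ map col (vertex_list n)) (counter n a 0) (counter n b 0))"
proof -
  define S1 where "S1 i = conf X h (ys @ concat (map (\<lambda>u. [col (Left u), col (Right u)]) [0..<i]))
    (counter n a (int i)) (counter n b (int i))" for i
  define zs where "zs = ys @ concat (map (\<lambda>u. [col (Left u), col (Right u)]) [0..<n])"
  have 1: "runs (While (\<lambda>ss. ss ! 3 \<noteq> 0) (emit (scan_bit gA) ;; emit (scan_bit gB) ;; move 2 1 ;; move 3 1))
      (S1 0) (n * (1 + (1 + (1 + 1)) + 2) + 1) (S1 n)"
  proof (rule runs_While)
    fix i assume i: "i < n"
    have "runs (emit (scan_bit gA) ;; emit (scan_bit gB) ;; move 2 1 ;; move 3 1) (S1 i)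
        (1 + (1 + (1 + 1))) (S1 (Suc i))"
      unfolding S1_def
      \<comment> \<open>The rules compute some final tapes; \<open>back_subst\<close> leaves their
        equality with \<open>S1 (Suc i)\<close> to the simplifier.\<close>
      by (rule runs_Seq[OF runs_emit_scan_bit[OF refl] runs_Seq[OF runs_emit_scan_bit[OF refl]
            runs_Seq[OF runs_move2 runs_move3]], THEN back_subst[of "\<lambda>T. runs _ _ _ T"]])
        (simp add: i scanned_counter_mark assms add.commute)
    then show "map scanned (S1 i) ! 3 \<noteq> 0 \<and>
        runs (emit (scan_bit gA) ;; emit (scan_bit gB) ;; move 2 1 ;; move 3 1) (S1 i) (1 + (1 + (1 + 1))) (S1 (Suc i))"
      using i by (simp add: S1_def scanned_counter_nonzero)
  qed (simp add: S1_def scanned_counter)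
  \<comment> \<open>In the nested loop, tape 2 runs over the first coordinate of a flag and tape 3
    over the second.\<close>
  define S2 where "S2 i = conf X h (zs @ concat (map (\<lambda>u. concat (map (\<lambda>v. [col (LFlag u v), col (RFlag u v)]) [0..<n])) [0..<i]))
    (counter n a (int i)) (counter n b 0)" for i
  have 3: "runs (While (\<lambda>ss. ss ! 2 \<noteq> 0)
       (While (\<lambda>ss. ss ! 3 \<noteq> 0) (emit (scan_bit gF) ;; emit (scan_bit gG) ;; move 3 1) ;; rewind 3 ;; move 2 1))
     (S2 0) (n * ((n * (1 + (1 + 1) + 2) + 1 + (6 * Suc n + 1)) + 2) + 1) (S2 n)"
  proof (rule runs_While)
    fix i assume i: "i < n"
    define ws where "ws = zs @ concat (map (\<lambda>u. concat (map (\<lambda>v. [col (LFlag u v), col (RFlag u v)]) [0..<n])) [0..<i])"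
    define S3 where "S3 j = conf X h (ws @ concat (map (\<lambda>v. [col (LFlag i v), col (RFlag i v)]) [0..<j]))
      (counter n a (int i)) (counter n b (int j))" for j
    have 4: "runs (While (\<lambda>ss. ss ! 3 \<noteq> 0) (emit (scan_bit gF) ;; emit (scan_bit gG) ;; move 3 1))
      (S3 0) (n * (1 + (1 + 1) + 2) + 1) (S3 n)"
    proof (rule runs_While)
      fix j assume j: "j < n"
      have "runs (emit (scan_bit gF) ;; emit (scan_bit gG) ;; move 3 1) (S3 j) (1 + (1 + 1)) (S3 (Suc j))"
        unfolding S3_def
        by (rule runs_Seq[OF runs_emit_scan_bit[OF refl] runs_Seq[OF runs_emit_scan_bit[OF refl] runs_move3],
              THEN back_subst[of "\<lambda>T. runs _ _ _ T"]])
          (simp add: i j scanned_counter_mark assms add.commute)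
      then show "map scanned (S3 j) ! 3 \<noteq> 0 \<and>
          runs (emit (scan_bit gF) ;; emit (scan_bit gG) ;; move 3 1) (S3 j) (1 + (1 + 1)) (S3 (Suc j))"
        using j by (simp add: S3_def scanned_counter_nonzero)
    qed (simp add: S3_def scanned_counter)
    have 5: "runs (rewind 3 ;; move 2 1) (S3 n) (6 * Suc n + 1) (S2 (Suc i))"
      unfolding S3_def S2_def
      by (rule runs_Seq[OF runs_rewind3 runs_move2, THEN back_subst[of "\<lambda>T. runs _ _ _ T"]])
        (simp_all add: ws_def add.commute)
    have "S3 0 = S2 i" by (simp add: S3_def S2_def ws_def)
    then show "map scanned (S2 i) ! 2 \<noteq> 0 \<and> runs
        (While (\<lambda>ss. ss ! 3 \<noteq> 0) (emit (scan_bit gF) ;; emit (scan_bit gG) ;; move 3 1) ;; rewind 3 ;; move 2 1)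
        (S2 i) (n * (1 + (1 + 1) + 2) + 1 + (6 * Suc n + 1)) (S2 (Suc i))"
      using runs_Seq[OF 4 5] i by (simp add: S2_def scanned_counter_nonzero)
  qed (simp add: S2_def scanned_counter)
  have 6: "runs (rewind 2) (S2 n) (6 * Suc n)
      (conf X h (ys @ map col (vertex_list n)) (counter n a 0) (counter n b 0))"
    unfolding S2_def
    by (rule runs_rewind2[THEN back_subst[of "\<lambda>T. runs _ _ _ T"]])
      (simp_all add: zs_def vertex_list_def map_concat comp_def)
  obtain T where 21: "runs (rewind 2) (S1 n) (6 * Suc n) T" and 22: "runs (rewind 3) T (6 * Suc n) (S2 0)"
  proof
    show "runs (rewind 2) (S1 n) (6 * Suc n) (conf X h zs (counter n a 0) (counter n b (int n)))"
      unfolding S1_def zs_def by (rule runs_rewind2) simp_all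
    show "runs (rewind 3) (conf X h zs (counter n a 0) (counter n b (int n))) (6 * Suc n) (S2 0)"
      unfolding S2_def by (rule runs_rewind3[THEN back_subst[of "\<lambda>T. runs _ _ _ T"]]) simp_all
  qed
  have "S1 0 = conf X h ys (counter n a 0) (counter n b 0)" by (simp add: S1_def)
  then have "runs (row gA gB gF gG) (conf X h ys (counter n a 0) (counter n b 0))
     (n * (1 + (1 + (1 + 1)) + 2) + 1 + (6 * Suc n + (6 * Suc n +
       (n * ((n * (1 + (1 + 1) + 2) + 1 + (6 * Suc n + 1)) + 2) + 1 + 6 * Suc n))))
     (conf X h (ys @ map col (vertex_list n)) (counter n a 0) (counter n b 0))"
    using runs_Seq[OF 1 runs_Seq[OF 21 runs_Seq[OF 22 runs_Seq[OF 3 6]]]] by (simp only: row_def)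
  then show ?thesis
    by (rule runs_mono) (simp add: power2_eq_square algebra_simps)
qed

section \<open>Transforming one graph: programs and running times\<close>

definition load :: prog where
  "load = While (\<lambda>ss. ss ! 0 = 2) (put 2 1 1 ;; put 3 1 1 ;; move 0 1) ;;
     move 0 1 ;; rewind 2 ;; rewind 3"

text \<open>In round \<open>u\<close> both counters are marked at cell \<open>u\<close>. Since
  \<open>row\<close> needs their heads for the column indices, the marks alone remember
  \<open>u\<close>, and \<open>find_mark\<close> brings the heads back. The two rows belong to
  \<open>Left u\<close> and \<open>Right u\<close>; in flag columns, \<open>p\<close> tests the
  first coordinate and \<open>q\<close> the second.\<close>

definition vertex_row_pairs :: prog where
  "vertex_row_pairs =
     While (\<lambda>ss. ss ! 3 \<noteq> 0)
       ((put 2 2 0 ;; put 3 2 0 ;; rewind 2 ;; rewind 3) ;;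
        (row (\<lambda>e p q. False) (\<lambda>e p q. \<not> p) (\<lambda>e p q. p) (\<lambda>e p q. True) ;;
         row (\<lambda>e p q. \<not> p) (\<lambda>e p q. False) (\<lambda>e p q. True) (\<lambda>e p q. q)) ;;
        (find_mark 2 ;; find_mark 3 ;; put 2 1 1 ;; put 3 1 1)) ;;
     rewind 2 ;; rewind 3"

text \<open>
  The input head advances once per pair \<open>(u, v)\<close>, so it scans the entry \<open>(u, v)\<close> of the adjacency
  matrix while the rows of \<open>LFlag u v\<close> and \<open>RFlag u v\<close> are written.
\<close>

definition flag_row_pairs :: prog where
  "flag_row_pairs =
     While (\<lambda>ss. ss ! 2 \<noteq> 0)
       ((put 2 2 0 ;; rewind 2) ;;
        While (\<lambda>ss. ss ! 3 \<noteq> 0)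
          ((put 3 2 0 ;; rewind 3) ;;
           (row (\<lambda>e p q. p) (\<lambda>e p q. True) (\<lambda>e p q. False) (\<lambda>e p q. \<not> (p \<and> q \<and> e)) ;;
            row (\<lambda>e p q. True) (\<lambda>e p q. q) (\<lambda>e p q. \<not> (p \<and> q \<and> e)) (\<lambda>e p q. False)) ;;
           (find_mark 3 ;; put 3 1 1 ;; move 0 1)) ;;
        (rewind 3 ;; find_mark 2 ;; put 2 1 1)) ;;
     rewind 2"

text \<open>A row consisting of \<open>True\<close> only is the number of new vertices in unary, so
  the machine never has to compute this number. Clearing the counters makes the program
  repeatable.\<close>

definition transform_graph :: prog where
  "transform_graph =
     load ;;
     (row (\<lambda>e p q. True) (\<lambda>e p q. True) (\<lambda>e p q. True) (\<lambda>e p q. True) ;; emit (\<lambda>ss. False)) ;;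
     vertex_row_pairs ;; flag_row_pairs ;; clear 2 ;; clear 3"

text \<open>The unary header is copied to both counters; the \<open>+ 1\<close> takes the input head
  past the separator to the start of the matrix.\<close>

lemma runs_load:
  assumes "\<And>i. i < n \<Longrightarrow> X (h + int i) = 2" "X (h + int n) \<noteq> 2"
  shows "runs load (conf X h ys (counter 0 (-1) 0) (counter 0 (-1) 0)) (20 * Suc n)
    (conf X (h + int n + 1) ys (counter n (-1) 0) (counter n (-1) 0))"
proof -
  define S where "S i = conf X (h + int i) ys (counter i (-1) (int i)) (counter i (-1) (int i))" for i
  have 1: "runs (While (\<lambda>ss. ss ! 0 = 2) (put 2 1 1 ;; put 3 1 1 ;; move 0 1)) (S 0)
      (n * (1 + (1 + 1) + 2) + 1) (S n)"
  proof (rule runs_While)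
    fix i assume i: "i < n"
    have "runs (put 2 1 1 ;; put 3 1 1 ;; move 0 1) (S i) (1 + (1 + 1)) (S (Suc i))"
      unfolding S_def
      by (rule runs_Seq[OF runs_put2[OF refl] runs_Seq[OF runs_put3[OF refl] runs_move_input],
            THEN back_subst[of "\<lambda>T. runs _ _ _ T"]])
        (simp add: act_counter_extend ac_simps del: One_nat_def)
    then show "map scanned (S i) ! 0 = 2 \<and>
        runs (put 2 1 1 ;; put 3 1 1 ;; move 0 1) (S i) (1 + (1 + 1)) (S (Suc i))"
      using assms(1)[OF i] by (simp add: S_def)
  qed (use assms(2) in \<open>simp add: S_def\<close>)
  have 2: "runs (move 0 1 ;; rewind 2 ;; rewind 3) (S n) (1 + (6 * Suc n + 6 * Suc n))
      (conf X (h + int n + 1) ys (counter n (-1) 0) (counter n (-1) 0))"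
    unfolding S_def
    by (rule runs_Seq[OF runs_move_input runs_Seq[OF runs_rewind2 runs_rewind3]]) simp_all
  have "S 0 = conf X h ys (counter 0 (-1) 0) (counter 0 (-1) 0)" by (simp add: S_def)
  then have "runs load (conf X h ys (counter 0 (-1) 0) (counter 0 (-1) 0))
      (n * (1 + (1 + 1) + 2) + 1 + (1 + (6 * Suc n + 6 * Suc n)))
      (conf X (h + int n + 1) ys (counter n (-1) 0) (counter n (-1) 0))"
    using runs_Seq[OF 1 2] by (simp only: load_def)
  then show ?thesis by (rule runs_mono) simp
qed

lemma runs_vertex_row_pairs:
  "runs vertex_row_pairs (conf X h ys (counter n (-1) 0) (counter n (-1) 0)) (120 * Suc n ^ 3)
    (conf X h (ys @ concat (map (\<lambda>u. map (adj E (Left u)) (vertex_list n) @ map (adj E (Right u)) (vertex_list n)) [0..<n]))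
      (counter n (-1) 0) (counter n (-1) 0))"
proof -
  define out where "out i = ys @
    concat (map (\<lambda>u. map (adj E (Left u)) (vertex_list n) @ map (adj E (Right u)) (vertex_list n)) [0..<i])" for i
  define S where "S i = conf X h (out i) (counter n (-1) (int i)) (counter n (-1) (int i))" for i
  let ?t = "1 + (1 + (6 * Suc n + 6 * Suc n)) + (25 * Suc n ^ 2 + 25 * Suc n ^ 2 +
    (6 * Suc n + (6 * Suc n + (1 + 1))))"
  have loop: "runs (While (\<lambda>ss. ss ! 3 \<noteq> 0)
       ((put 2 2 0 ;; put 3 2 0 ;; rewind 2 ;; rewind 3) ;;
        (row (\<lambda>e p q. False) (\<lambda>e p q. \<not> p) (\<lambda>e p q. p) (\<lambda>e p q. True) ;;
         row (\<lambda>e p q. \<not> p) (\<lambda>e p q. False) (\<lambda>e p q. True) (\<lambda>e p q. q)) ;;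
        (find_mark 2 ;; find_mark 3 ;; put 2 1 1 ;; put 3 1 1))) (S 0) (n * (?t + 2) + 1) (S n)"
  proof (rule runs_While)
    fix i assume i: "i < n"
    have 1: "runs (put 2 2 0 ;; put 3 2 0 ;; rewind 2 ;; rewind 3) (S i)
        (1 + (1 + (6 * Suc n + 6 * Suc n)))
        (conf X h (out i) (counter n (int i) 0) (counter n (int i) 0))"
      unfolding S_def
      by (rule runs_Seq[OF runs_put2 runs_Seq[OF runs_put3 runs_Seq[OF runs_rewind2[of "int i"] runs_rewind3[of "int i"]]]])
        (use i in \<open>simp_all add: act_counter_mark\<close>)
    have 2: "runs (row (\<lambda>e p q. False) (\<lambda>e p q. \<not> p) (\<lambda>e p q. p) (\<lambda>e p q. True) ;;
         row (\<lambda>e p q. \<not> p) (\<lambda>e p q. False) (\<lambda>e p q. True) (\<lambda>e p q. q))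
        (conf X h (out i) (counter n (int i) 0) (counter n (int i) 0)) (25 * Suc n ^ 2 + 25 * Suc n ^ 2)
        (conf X h ((out i @ map (adj E (Left i)) (vertex_list n)) @ map (adj E (Right i)) (vertex_list n))
          (counter n (int i) 0) (counter n (int i) 0))"
      by (intro runs_Seq[OF runs_row runs_row]) auto
    have 3: "runs (find_mark 2 ;; find_mark 3 ;; put 2 1 1 ;; put 3 1 1)
        (conf X h zs (counter n (int i) 0) (counter n (int i) 0)) (6 * Suc n + (6 * Suc n + (1 + 1)))
        (conf X h zs (counter n (-1) (int i + 1)) (counter n (-1) (int i + 1)))" for zs
      by (rule runs_Seq[OF runs_find_mark2 runs_Seq[OF runs_find_mark3 runs_Seq[OF runs_put2 runs_put3]]])
        (use i in \<open>simp_all add: act_counter_unmark del: One_nat_def\<close>)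
    have "S (Suc i) = conf X h ((out i @ map (adj E (Left i)) (vertex_list n)) @ map (adj E (Right i)) (vertex_list n))
        (counter n (-1) (int i + 1)) (counter n (-1) (int i + 1))"
      by (simp add: S_def out_def add.commute)
    then show "map scanned (S i) ! 3 \<noteq> 0 \<and> runs
       ((put 2 2 0 ;; put 3 2 0 ;; rewind 2 ;; rewind 3) ;;
        (row (\<lambda>e p q. False) (\<lambda>e p q. \<not> p) (\<lambda>e p q. p) (\<lambda>e p q. True) ;;
         row (\<lambda>e p q. \<not> p) (\<lambda>e p q. False) (\<lambda>e p q. True) (\<lambda>e p q. q)) ;;
        (find_mark 2 ;; find_mark 3 ;; put 2 1 1 ;; put 3 1 1)) (S i) ?t (S (Suc i))"
      using runs_Seq[OF 1 runs_Seq[OF 2 3]] i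
      by (simp only: S_def scanned_conf scanned_counter_nonzero neq0_conv simp_thms)
  qed (simp add: S_def scanned_counter)
  have final: "runs (rewind 2 ;; rewind 3) (S n) (6 * Suc n + 6 * Suc n)
      (conf X h (out n) (counter n (-1) 0) (counter n (-1) 0))"
    unfolding S_def by (rule runs_Seq[OF runs_rewind2 runs_rewind3]) simp_all
  have start: "S 0 = conf X h ys (counter n (-1) 0) (counter n (-1) 0)"
    by (simp add: S_def out_def)
  have "runs vertex_row_pairs (conf X h ys (counter n (-1) 0) (counter n (-1) 0))
      (n * (?t + 2) + 1 + (6 * Suc n + 6 * Suc n)) (conf X h (out n) (counter n (-1) 0) (counter n (-1) 0))"
    using runs_Seq[OF loop final] unfolding start vertex_row_pairs_def .
  then show ?thesis
    unfolding out_def by (rule runs_mono) (simp add: power2_eq_square power3_eq_cube algebra_simps)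
qed

lemma runs_flag_row_pairs:
  assumes "\<And>u v. u < n \<Longrightarrow> v < n \<Longrightarrow> X (h + int (u * n + v)) = 2 \<longleftrightarrow> E u v"
  shows "runs flag_row_pairs (conf X h ys (counter n (-1) 0) (counter n (-1) 0)) (120 * Suc n ^ 4)
    (conf X (h + int (n * n)) (ys @ concat (map (\<lambda>u. concat (map (\<lambda>v.
        map (adj E (LFlag u v)) (vertex_list n) @ map (adj E (RFlag u v)) (vertex_list n)) [0..<n])) [0..<n]))
      (counter n (-1) 0) (counter n (-1) 0))"
proof -
  define rows where "rows u v = map (adj E (LFlag u v)) (vertex_list n) @ map (adj E (RFlag u v)) (vertex_list n)" for u v
  define out where "out i = ys @ concat (map (\<lambda>u. concat (map (rows u) [0..<n])) [0..<i])" for i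
  define S where "S i = conf X (h + int (i * n)) (out i) (counter n (-1) (int i)) (counter n (-1) 0)" for i
  let ?rows = "(put 3 2 0 ;; rewind 3) ;;
    (row (\<lambda>e p q. p) (\<lambda>e p q. True) (\<lambda>e p q. False) (\<lambda>e p q. \<not> (p \<and> q \<and> e)) ;;
     row (\<lambda>e p q. True) (\<lambda>e p q. q) (\<lambda>e p q. \<not> (p \<and> q \<and> e)) (\<lambda>e p q. False)) ;;
    (find_mark 3 ;; put 3 1 1 ;; move 0 1)"
  let ?loop = "While (\<lambda>ss. ss ! 3 \<noteq> 0) ?rows"
  let ?body = "(put 2 2 0 ;; rewind 2) ;; ?loop ;; (rewind 3 ;; find_mark 2 ;; put 2 1 1)"
  let ?t = "1 + 6 * Suc n + (25 * Suc n ^ 2 + 25 * Suc n ^ 2 + (6 * Suc n + (1 + 1)))"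
  let ?t' = "1 + 6 * Suc n + (n * (?t + 2) + 1 + (6 * Suc n + (6 * Suc n + 1)))"
  have loop: "runs (While (\<lambda>ss. ss ! 2 \<noteq> 0) ?body) (S 0) (n * (?t' + 2) + 1) (S n)"
  proof (rule runs_While)
    fix i assume i: "i < n"
    \<comment> \<open>Throughout round \<open>i\<close>, tape 2 keeps its mark at \<open>i\<close>;
      the head of tape 3 is the inner loop variable, and its mark is absent between inner
      rounds.\<close>
    define R where "R j = conf X (h + int (i * n) + int j) (out i @ concat (map (rows i) [0..<j]))
      (counter n (int i) 0) (counter n (-1) (int j))" for j
    have 1: "runs (put 2 2 0 ;; rewind 2) (S i) (1 + 6 * Suc n) (R 0)"
      unfolding S_def R_def
      by (rule runs_Seq[OF runs_put2 runs_rewind2[of "int i"], THEN back_subst[of "\<lambda>T. runs _ _ _ T"]])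
        (use i in \<open>simp_all add: act_counter_mark\<close>)
    have 2: "runs ?loop (R 0) (n * (?t + 2) + 1) (R n)"
    proof (rule runs_While)
      fix j assume j: "j < n"
      define k where "k = h + int (i * n) + int j"
      define zs where "zs = out i @ concat (map (rows i) [0..<j])"
      have E: "X k = 2 \<longleftrightarrow> E i j" using assms[OF i j] by (simp add: k_def add.assoc)
      have 3: "runs (put 3 2 0 ;; rewind 3) (R j) (1 + 6 * Suc n)
          (conf X k zs (counter n (int i) 0) (counter n (int j) 0))"
        unfolding R_def k_def[symmetric] zs_def[symmetric]
        by (rule runs_Seq[OF runs_put3 runs_rewind3[of "int j"]])
          (use j in \<open>simp_all add: act_counter_mark\<close>)
      have 4: "runs (row (\<lambda>e p q. p) (\<lambda>e p q. True) (\<lambda>e p q. False) (\<lambda>e p q. \<not> (p \<and> q \<and> e)) ;;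
           row (\<lambda>e p q. True) (\<lambda>e p q. q) (\<lambda>e p q. \<not> (p \<and> q \<and> e)) (\<lambda>e p q. False))
          (conf X k zs (counter n (int i) 0) (counter n (int j) 0)) (25 * Suc n ^ 2 + 25 * Suc n ^ 2)
          (conf X k ((zs @ map (adj E (LFlag i j)) (vertex_list n)) @ map (adj E (RFlag i j)) (vertex_list n))
            (counter n (int i) 0) (counter n (int j) 0))"
        by (intro runs_Seq[OF runs_row runs_row]) (auto simp: E)
      have 5: "runs (find_mark 3 ;; put 3 1 1 ;; move 0 1)
          (conf X k ws (counter n (int i) 0) (counter n (int j) 0)) (6 * Suc n + (1 + 1))
          (conf X (k + 1) ws (counter n (int i) 0) (counter n (-1) (int j + 1)))" for ws
        by (rule runs_Seq[OF runs_find_mark3 runs_Seq[OF runs_put3 runs_move_input]])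
          (use j in \<open>simp_all add: act_counter_unmark del: One_nat_def\<close>)
      have "R (Suc j) = conf X (k + 1)
          ((zs @ map (adj E (LFlag i j)) (vertex_list n)) @ map (adj E (RFlag i j)) (vertex_list n))
          (counter n (int i) 0) (counter n (-1) (int j + 1))"
        by (simp add: R_def k_def zs_def rows_def ac_simps)
      then show "map scanned (R j) ! 3 \<noteq> 0 \<and> runs ?rows (R j) ?t (R (Suc j))"
        using runs_Seq[OF 3 runs_Seq[OF 4 5]] j
        by (simp only: R_def scanned_conf scanned_counter_nonzero neq0_conv simp_thms)
    qed (simp add: R_def scanned_counter)
    have 6: "runs (rewind 3 ;; find_mark 2 ;; put 2 1 1) (R n) (6 * Suc n + (6 * Suc n + 1)) (S (Suc i))"
      unfolding S_def R_def
      by (rule runs_Seq[OF runs_rewind3 runs_Seq[OF runs_find_mark2 runs_put2],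
            THEN back_subst[of "\<lambda>T. runs _ _ _ T"]])
        (use i in \<open>simp_all add: act_counter_unmark out_def ac_simps del: One_nat_def\<close>)
    show "map scanned (S i) ! 2 \<noteq> 0 \<and> runs ?body (S i) ?t' (S (Suc i))"
      using runs_Seq[OF 1 runs_Seq[OF 2 6]] i
      by (simp only: S_def scanned_conf scanned_counter_nonzero neq0_conv simp_thms)
  qed (simp add: S_def scanned_counter)
  have final: "runs (rewind 2) (S n) (6 * Suc n)
      (conf X (h + int (n * n)) (out n) (counter n (-1) 0) (counter n (-1) 0))"
    unfolding S_def by (rule runs_rewind2) simp_all
  have start: "S 0 = conf X h ys (counter n (-1) 0) (counter n (-1) 0)"
    by (simp add: S_def out_def)
  have "runs flag_row_pairs (conf X h ys (counter n (-1) 0) (counter n (-1) 0))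
      (n * (?t' + 2) + 1 + 6 * Suc n)
      (conf X (h + int (n * n)) (out n) (counter n (-1) 0) (counter n (-1) 0))"
    using runs_Seq[OF loop final] unfolding start flag_row_pairs_def .
  then show ?thesis
    unfolding out_def rows_def
    by (rule runs_mono) (simp add: power2_eq_square power4_eq_xxxx algebra_simps)
qed

text \<open>The gadget in the form in which the machine prints it, later identified with
  \<open>encode_graph\<close> of the numbered gadget.\<close>

definition gadget_code :: "nat \<Rightarrow> (nat \<Rightarrow> nat \<Rightarrow> bool) \<Rightarrow> bool list" where
  "gadget_code n E = replicate (length (vertex_list n)) True @ [False] @
     concat (map (\<lambda>x. map (adj E x) (vertex_list n)) (vertex_list n))"

lemma concat_map_concat: "concat (map f (concat xss)) = concat (map (\<lambda>xs. concat (map f xs)) xss)"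
  by (induction xss) auto

lemma concat_map_vertex_list:
  "concat (map f (vertex_list n)) = concat (map (\<lambda>u. f (Left u) @ f (Right u)) [0..<n]) @
     concat (map (\<lambda>u. concat (map (\<lambda>v. f (LFlag u v) @ f (RFlag u v)) [0..<n])) [0..<n])"
  by (simp add: vertex_list_def concat_map_concat comp_def)

text \<open>Only the cells of one encoded graph are constrained, so it may lie anywhere on the input
  tape; the head ends directly behind it.\<close>

lemma runs_transform_graph:
  assumes "\<And>i. i < n \<Longrightarrow> X (h + int i) = 2" "X (h + int n) \<noteq> 2"
    and "\<And>u v. u < n \<Longrightarrow> v < n \<Longrightarrow> X (h + int n + 1 + int (u * n + v)) = 2 \<longleftrightarrow> E u v"
  shows "runs transform_graph (conf X h ys (counter 0 (-1) 0) (counter 0 (-1) 0)) (300 * Suc n ^ 4)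
    (conf X (h + int n + 1 + int (n * n)) (ys @ gadget_code n E) (counter 0 (-1) 0) (counter 0 (-1) 0))"
proof -
  let ?k = "h + int n + 1"
  let ?header = "(ys @ map (\<lambda>_. True) (vertex_list n)) @ [False]"
  have 1: "runs load (conf X h ys (counter 0 (-1) 0) (counter 0 (-1) 0)) (20 * Suc n)
      (conf X ?k ys (counter n (-1) 0) (counter n (-1) 0))"
    using assms(1,2) by (rule runs_load)
  have 2: "runs (row (\<lambda>e p q. True) (\<lambda>e p q. True) (\<lambda>e p q. True) (\<lambda>e p q. True) ;; emit (\<lambda>ss. False))
      (conf X ?k ys (counter n (-1) 0) (counter n (-1) 0)) (25 * Suc n ^ 2 + 1)
      (conf X ?k ?header (counter n (-1) 0) (counter n (-1) 0))"
    by (rule runs_Seq[OF runs_row runs_emit]) simp_all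
  have 3: "runs (clear 2 ;; clear 3) (conf X k zs (counter n (-1) 0) (counter n (-1) 0))
      (6 * Suc n + 6 * Suc n) (conf X k zs (counter 0 (-1) 0) (counter 0 (-1) 0))" for k zs
    by (rule runs_Seq[OF runs_clear2 runs_clear3])
  note 4 = runs_flag_row_pairs[of n X ?k E, OF assms(3)]
  have header: "ys @ gadget_code n E = ?header @ concat (map (\<lambda>x. map (adj E x) (vertex_list n)) (vertex_list n))"
    by (simp add: gadget_code_def map_replicate_const)
  have "runs transform_graph (conf X h ys (counter 0 (-1) 0) (counter 0 (-1) 0))
      (20 * Suc n + (25 * Suc n ^ 2 + 1 + (120 * Suc n ^ 3 + (120 * Suc n ^ 4 + (6 * Suc n + 6 * Suc n)))))
      (conf X (?k + int (n * n)) (ys @ gadget_code n E) (counter 0 (-1) 0) (counter 0 (-1) 0))"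
    unfolding transform_graph_def header concat_map_vertex_list append_assoc[symmetric]
    by (rule runs_Seq[OF 1 runs_Seq[OF 2 runs_Seq[OF runs_vertex_row_pairs runs_Seq[OF 4 3]]]])
  then show ?thesis
    by (rule runs_mono) (simp add: power2_eq_square power3_eq_cube power4_eq_xxxx algebra_simps)
qed

section \<open>Encodings and running times\<close>

lemma well_formed_move [simp]: "i < k \<Longrightarrow> d \<in> {-1, 0, 1} \<Longrightarrow> well_formed k m (move i d)"
  unfolding move_def stay_def
  by (auto dest!: set_update_subset_insert[THEN subsetD] dest: nth_mem)

lemma well_formed_put [simp]: "a < m \<Longrightarrow> d \<in> {-1, 0, 1} \<Longrightarrow> well_formed k m (put i a d)"
  unfolding put_def stay_def by (auto dest!: set_update_subset_insert[THEN subsetD])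

lemma well_formed_emit [simp]: "3 \<le> m \<Longrightarrow> well_formed k m (emit g)"
  unfolding emit_def stay_def by (auto dest!: set_update_subset_insert[THEN subsetD])

lemma well_formed_transform_graph: "well_formed 4 3 transform_graph"
  by (simp add: transform_graph_def load_def vertex_row_pairs_def flag_row_pairs_def row_def
      clear_def rewind_def find_mark_def)

lemma initial_conf:
  "(written x, 0) # replicate (4 - 1) (written [], 0) =
     conf (written x) 0 [] (counter 0 (-1) 0) (counter 0 (-1) 0)"
  by (auto simp: conf_def output_tape_def counter_def numeral_3_eq_3 written_def fun_eq_iff)

text \<open>Even the identity takes a machine, as the output has to stand on tape 1. Each copied bit
  costs two instructions and two steps of loop overhead, and the last test costs one step, hence the
  polynomial \<open>[:1, 4:]\<close>.\<close>

lemma polytime_id: "polytime_on D (\<lambda>x. x)"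
  unfolding polytime_on_def
proof (intro exI[of _ "machine 4 3 (While (\<lambda>ss. ss ! 0 \<noteq> 0) (emit (\<lambda>ss. ss ! 0 = 2) ;; move 0 1))"]
    exI[of _ "[:1, 4:]"] conjI ballI)
  show "valid_tm (machine 4 3 (While (\<lambda>ss. ss ! 0 \<noteq> 0) (emit (\<lambda>ss. ss ! 0 = 2) ;; move 0 1)))"
    by (rule valid_machine) simp_all
next
  fix x :: "bool list"
  define S where "S i = conf (written x) (int i) (take i x) (counter 0 (-1) 0) (counter 0 (-1) 0)" for i
  have "runs (While (\<lambda>ss. ss ! 0 \<noteq> 0) (emit (\<lambda>ss. ss ! 0 = 2) ;; move 0 1)) (S 0)
      (length x * (1 + 1 + 2) + 1) (S (length x))"
  proof (rule runs_While)
    fix i assume i: "i < length x"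
    have Suc_i: "int (Suc i) = int i + 1" by simp
    have "runs (emit (\<lambda>ss. ss ! 0 = 2) ;; move 0 1) (S i) (1 + 1) (S (Suc i))"
      unfolding S_def take_Suc_conv_app_nth[OF i] Suc_i
      by (rule runs_Seq[OF runs_emit runs_move_input]) (use i in \<open>simp add: written_def\<close>)
    then show "map scanned (S i) ! 0 \<noteq> 0 \<and> runs (emit (\<lambda>ss. ss ! 0 = 2) ;; move 0 1) (S i) (1 + 1) (S (Suc i))"
      using i by (simp add: S_def written_def)
  qed (simp add: S_def written_def)
  moreover have "S 0 = (written x, 0) # replicate (4 - 1) (written [], 0)"
    unfolding initial_conf by (simp add: S_def)
  ultimately have "runs (While (\<lambda>ss. ss ! 0 \<noteq> 0) (emit (\<lambda>ss. ss ! 0 = 2) ;; move 0 1))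
      ((written x, 0) # replicate (4 - 1) (written [], 0)) (length x * (1 + 1 + 2) + 1) (S (length x))"
    by (simp only:)
  then show "outputs_within (machine 4 3 (While (\<lambda>ss. ss ! 0 \<noteq> 0) (emit (\<lambda>ss. ss ! 0 = 2) ;; move 0 1)))
      x (poly [:1, 4:] (length x)) x"
    by (rule outputs_within_machine) (simp_all add: S_def conf_def output_tape_def)
qed

definition adjacent :: "nat sgraph \<Rightarrow> nat \<Rightarrow> nat \<Rightarrow> bool" where
  "adjacent K u v \<longleftrightarrow> {u, v} \<in> edges K"

definition matrix :: "(nat \<Rightarrow> nat \<Rightarrow> bool) \<Rightarrow> nat \<Rightarrow> nat \<Rightarrow> bool list" where
  "matrix E m n = concat (map (\<lambda>i. map (E i) [0..<n]) [0..<m])"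

lemma length_matrix [simp]: "length (matrix E m n) = m * n"
  by (simp add: matrix_def length_concat comp_def sum_list_triv)

lemma nth_matrix: "u < m \<Longrightarrow> v < n \<Longrightarrow> matrix E m n ! (u * n + v) = E u v"
proof (induction m)
  case (Suc m)
  have Suc_matrix: "matrix E (Suc m) n = matrix E m n @ map (E m) [0..<n]"
    by (simp add: matrix_def)
  show ?case
  proof (cases "u = m")
    case True
    then show ?thesis using Suc.prems by (simp add: Suc_matrix nth_append)
  next
    case False
    then have "u < m" using Suc.prems by simp
    moreover have "u * n + v < m * n"
      using mult_le_mono1[of "Suc u" m n] \<open>u < m\<close> Suc.prems by simp
    ultimately show ?thesis using Suc by (simp add: Suc_matrix nth_append)
  qed
qed simp

lemma encode_graph_eq:
  "encode_graph K = replicate (card (verts K)) True @ [False] @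
     matrix (adjacent K) (card (verts K)) (card (verts K))"
  by (simp add: encode_graph_def matrix_def adjacent_def[abs_def] Let_def)

lemma written_nth:
  "k < length x \<Longrightarrow> written x (int k) = (if x ! k then 2 else 1)"
  by (simp add: written_def)

text \<open>The surrounding strings \<open>pre\<close> and \<open>post\<close> cover both components
  of an encoded pair.\<close>

lemma runs_transform_encoded_graph:
  fixes K :: "nat sgraph" and pre post :: "bool list"
  defines "n \<equiv> card (verts K)" and "x \<equiv> pre @ encode_graph K @ post"
  shows "runs transform_graph
    (conf (written x) (int (length pre)) ys (counter 0 (-1) 0) (counter 0 (-1) 0)) (300 * Suc n ^ 4)
    (conf (written x) (int (length (pre @ encode_graph K))) (ys @ gadget_code n (adjacent K))
      (counter 0 (-1) 0) (counter 0 (-1) 0))"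
proof -
  have x: "x = pre @ replicate n True @ [False] @ matrix (adjacent K) n n @ post"
    by (simp add: x_def encode_graph_eq n_def)
  have "runs transform_graph
    (conf (written x) (int (length pre)) ys (counter 0 (-1) 0) (counter 0 (-1) 0)) (300 * Suc n ^ 4)
    (conf (written x) (int (length pre) + int n + 1 + int (n * n)) (ys @ gadget_code n (adjacent K))
      (counter 0 (-1) 0) (counter 0 (-1) 0))"
  proof (rule runs_transform_graph)
    fix i assume "i < n"
    then show "written x (int (length pre) + int i) = 2"
      using written_nth[of "length pre + i" x] by (simp add: x nth_append)
  next
    show "written x (int (length pre) + int n) \<noteq> 2"
      using written_nth[of "length pre + n" x] by (simp add: x nth_append)
  next
    fix u v assume uv: "u < n" "v < n"
    have less: "u * n + v < n * n"
      using mult_le_mono1[of "Suc u" n n] uv by simp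
    have "x ! (length pre + n + 1 + (u * n + v)) = adjacent K u v"
      using less nth_matrix[OF uv] by (simp add: x nth_append)
    then show "written x (int (length pre) + int n + 1 + int (u * n + v)) = 2 \<longleftrightarrow> adjacent K u v"
      using written_nth[of "length pre + n + 1 + (u * n + v)" x] less by (simp add: x ac_simps)
  qed
  moreover have "int (length (pre @ encode_graph K)) = int (length pre) + int n + 1 + int (n * n)"
    by (simp add: encode_graph_eq n_def)
  ultimately show ?thesis by (simp only:)
qed

definition gadget_pair_code :: "nat sgraph \<Rightarrow> nat sgraph \<Rightarrow> bool list" where
  "gadget_pair_code K L = gadget_code (card (verts K)) (adjacent K) @ gadget_code (card (verts L)) (adjacent L)"

text \<open>The same program is run twice in a row, once for each graph of the pair.\<close>

lemma polytime_gadget_pair: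
  assumes "\<And>x. x \<in> D \<Longrightarrow> \<exists>K L. x = encode_graph K @ encode_graph L \<and> f x = gadget_pair_code K L"
  shows "polytime_on D f"
  unfolding polytime_on_def
proof (intro exI[of _ "machine 4 3 (transform_graph ;; transform_graph)"]
    exI[of _ "[:600:] * [:1, 1:] ^ 4"] conjI ballI)
  show "valid_tm (machine 4 3 (transform_graph ;; transform_graph))"
    by (rule valid_machine) (simp_all add: well_formed_transform_graph)
next
  fix x assume "x \<in> D"
  then obtain K L where x: "x = encode_graph K @ encode_graph L" and fx: "f x = gadget_pair_code K L"
    using assms by blast
  let ?k = "card (verts K)" and ?l = "card (verts L)"
  have "runs transform_graph (conf (written x) 0 [] (counter 0 (-1) 0) (counter 0 (-1) 0)) (300 * Suc ?k ^ 4)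
      (conf (written x) (int (length (encode_graph K))) (gadget_code ?k (adjacent K)) (counter 0 (-1) 0) (counter 0 (-1) 0))"
    using runs_transform_encoded_graph[of "[]" K "encode_graph L" "[]"] by (simp add: x)
  moreover have "runs transform_graph
      (conf (written x) (int (length (encode_graph K))) (gadget_code ?k (adjacent K)) (counter 0 (-1) 0) (counter 0 (-1) 0))
      (300 * Suc ?l ^ 4)
      (conf (written x) (int (length x)) (f x) (counter 0 (-1) 0) (counter 0 (-1) 0))"
    using runs_transform_encoded_graph[of "encode_graph K" L "[]" "gadget_code ?k (adjacent K)"]
    by (simp add: x fx[unfolded x] gadget_pair_code_def)
  ultimately have run: "runs (transform_graph ;; transform_graph)
      ((written x, 0) # replicate (4 - 1) (written [], 0)) (300 * Suc ?k ^ 4 + 300 * Suc ?l ^ 4)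
      (conf (written x) (int (length x)) (f x) (counter 0 (-1) 0) (counter 0 (-1) 0))"
    unfolding initial_conf by (rule runs_Seq)
  have bound: "300 * Suc ?k ^ 4 + 300 * Suc ?l ^ 4 \<le> poly ([:600:] * [:1, 1:] ^ 4) (length x)"
  proof -
    \<comment> \<open>The unary header makes the number of vertices at most the length of the
      input.\<close>
    have "Suc ?k ^ 4 \<le> Suc (length x) ^ 4" "Suc ?l ^ 4 \<le> Suc (length x) ^ 4"
      by (rule power_mono; simp add: x encode_graph_eq)+
    then have "300 * Suc ?k ^ 4 + 300 * Suc ?l ^ 4 \<le> 600 * Suc (length x) ^ 4" by linarith
    also have "\<dots> = poly ([:600:] * [:1, 1:] ^ 4) (length x)" by (simp add: poly_power)
    finally show ?thesis .
  qed
  show "outputs_within (machine 4 3 (transform_graph ;; transform_graph)) x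
      (poly ([:600:] * [:1, 1:] ^ 4) (length x)) (f x)"
    by (rule outputs_within_machine[OF run _ bound]) (simp add: conf_def output_tape_def)
qed

lemma standard_graph_eqI:
  assumes "standard_graph K" "standard_graph L" "card (verts K) = card (verts L)"
    and "\<And>u v. u < card (verts K) \<Longrightarrow> v < card (verts K) \<Longrightarrow> adjacent K u v \<longleftrightarrow> adjacent L u v"
  shows "K = L"
proof -
  have verts: "verts K = {..<card (verts K)}" "verts L = {..<card (verts K)}"
    using assms(1-3) by (auto simp: standard_graph_def)
  have "e \<in> edges M'" if "e \<in> edges M" and M: "standard_graph M" "verts M = {..<card (verts K)}"
    and *: "\<And>u v. u < card (verts K) \<Longrightarrow> v < card (verts K) \<Longrightarrow> adjacent M u v \<Longrightarrow> adjacent M' u v"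
    for e and M M' :: "nat sgraph"
  proof -
    have "e \<subseteq> verts M" "card e = 2"
      using that(1) M by (auto simp: standard_graph_def simple_graph_def)
    then obtain u v where "e = {u, v}" "u < card (verts K)" "v < card (verts K)"
      using M(2) by (auto simp: card_2_iff)
    then show ?thesis using *[of u v] that(1) by (simp add: adjacent_def)
  qed
  from this[of _ K L] this[of _ L K] have "edges K = edges L"
    using assms verts by blast
  then show ?thesis using verts by (cases K; cases L) simp
qed

text \<open>The header ends at the first \<open>False\<close>, so it determines the number of
  vertices and thereby where the matrix ends.\<close>

lemma encode_graph_append_inject:
  assumes "standard_graph K" "standard_graph L" "encode_graph K @ r = encode_graph L @ s"
  shows "K = L \<and> r = s"
proof -
  let ?k = "card (verts K)" and ?l = "card (verts L)"
  have len: "length (takeWhile id (encode_graph M @ t)) = card (verts M)" for M t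
    by (simp add: encode_graph_eq takeWhile_append takeWhile_replicate)
  have k: "?k = ?l" using len[of K r] len[of L s] assms(3) by simp
  then have eq: "matrix (adjacent K) ?k ?k = matrix (adjacent L) ?k ?k" "r = s"
    using assms(3) by (simp_all add: encode_graph_eq)
  have "K = L"
  proof (rule standard_graph_eqI[OF assms(1,2) k])
    show "adjacent K u v \<longleftrightarrow> adjacent L u v" if "u < ?k" "v < ?k" for u v
      using nth_matrix[OF that] eq(1) by metis
  qed
  with eq(2) show ?thesis by simp
qed

section \<open>Recovering the graph from its gadget\<close>

definition gadget_vertices :: "nat \<Rightarrow> gadget_vertex set" where
  "gadget_vertices n = set (vertex_list n)"

lemma gadget_vertices_eq:
  "gadget_vertices n = Left ` {..<n} \<union> Right ` {..<n} \<union>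
     case_prod LFlag ` ({..<n} \<times> {..<n}) \<union> case_prod RFlag ` ({..<n} \<times> {..<n})"
  by (auto simp: vertex_list_def gadget_vertices_def)

lemma in_gadget_vertices [simp]:
  "Left u \<in> gadget_vertices n \<longleftrightarrow> u < n"
  "Right u \<in> gadget_vertices n \<longleftrightarrow> u < n"
  "LFlag u v \<in> gadget_vertices n \<longleftrightarrow> u < n \<and> v < n"
  "RFlag u v \<in> gadget_vertices n \<longleftrightarrow> u < n \<and> v < n"
  by (auto simp: vertex_list_def gadget_vertices_def)

lemma card_images [simp]:
  "card (Left ` X) = card X" "card (Right ` X) = card X" "card (case_prod LFlag ` Z) = card Z"
  "card (case_prod RFlag ` Z) = card Z" "card (LFlag u ` X) = card X" "card ((\<lambda>a. RFlag a u) ` X) = card X"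
  by (auto intro!: card_image simp: inj_on_def)

lemma card_gadget_vertices: "card (gadget_vertices n) = 2 * n + 2 * (n * n)"
  unfolding gadget_vertices_eq by (subst card_Un_disjoint; auto)+

lemma distinct_vertex_list: "distinct (vertex_list n)"
proof (rule card_distinct)
  have "length (vertex_list n) = 2 * n + 2 * (n * n)"
    by (simp add: vertex_list_def length_concat comp_def sum_list_triv)
  then show "card (set (vertex_list n)) = length (vertex_list n)"
    using card_gadget_vertices[of n] by (simp add: gadget_vertices_def)
qed

section \<open>Degrees in the gadget\<close>

definition vertex_degree :: "nat \<Rightarrow> (nat \<Rightarrow> nat \<Rightarrow> bool) \<Rightarrow> gadget_vertex \<Rightarrow> nat" where
  "vertex_degree n E x = card {y \<in> gadget_vertices n. adj E x y}"

lemma vertex_degree_Left: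
  assumes "u < n" shows "vertex_degree n E (Left u) = (n - 1) + n + n * n"
proof -
  have "{y \<in> gadget_vertices n. adj E (Left u) y} =
      Right ` ({..<n} - {u}) \<union> LFlag u ` {..<n} \<union> case_prod RFlag ` ({..<n} \<times> {..<n})"
    using assms by (auto simp: gadget_vertices_eq)
  then show ?thesis
    unfolding vertex_degree_def using assms by (simp, subst card_Un_disjoint; auto)+
qed

lemma vertex_degree_Right:
  assumes "u < n" shows "vertex_degree n E (Right u) = (n - 1) + n + n * n"
proof -
  have "{y \<in> gadget_vertices n. adj E (Right u) y} =
      Left ` ({..<n} - {u}) \<union> (\<lambda>a. RFlag a u) ` {..<n} \<union> case_prod LFlag ` ({..<n} \<times> {..<n})"
    using assms by (auto simp: gadget_vertices_eq)
  then show ?thesis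
    unfolding vertex_degree_def using assms by (simp, subst card_Un_disjoint; auto)+
qed

lemma vertex_degree_LFlag:
  assumes "u < n" "v < n"
  shows "vertex_degree n E (LFlag u v) = 1 + n + (n * n - (if E u v then 1 else 0))"
proof -
  have "{y \<in> gadget_vertices n. adj E (LFlag u v) y} =
      Left ` {u} \<union> Right ` {..<n} \<union> case_prod RFlag ` ({..<n} \<times> {..<n} - (if E u v then {(u, v)} else {}))"
    using assms by (auto simp: gadget_vertices_eq split: if_splits)
  then show ?thesis
    unfolding vertex_degree_def using assms
    by (simp only:) (subst card_Un_disjoint; auto simp: card_insert_if card_Diff_singleton_if)+
qed

lemma vertex_degree_RFlag:
  assumes "u < n" "v < n"
  shows "vertex_degree n E (RFlag u v) = 1 + n + (n * n - (if E u v then 1 else 0))"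
proof -
  have "{y \<in> gadget_vertices n. adj E (RFlag u v) y} =
      Right ` {v} \<union> Left ` {..<n} \<union> case_prod LFlag ` ({..<n} \<times> {..<n} - (if E u v then {(u, v)} else {}))"
    using assms by (auto simp: gadget_vertices_eq split: if_splits)
  then show ?thesis
    unfolding vertex_degree_def using assms
    by (simp only:) (subst card_Un_disjoint; auto simp: card_insert_if card_Diff_singleton_if)+
qed

lemmas vertex_degree_simps = vertex_degree_Left vertex_degree_Right vertex_degree_LFlag vertex_degree_RFlag

section \<open>Isomorphisms between gadgets\<close>

definition gadget_iso ::
  "nat \<Rightarrow> (nat \<Rightarrow> nat \<Rightarrow> bool) \<Rightarrow> (nat \<Rightarrow> nat \<Rightarrow> bool) \<Rightarrow> (gadget_vertex \<Rightarrow> gadget_vertex) \<Rightarrow> bool" where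
  "gadget_iso n E E' f \<longleftrightarrow> bij_betw f (gadget_vertices n) (gadget_vertices n) \<and>
     (\<forall>x\<in>gadget_vertices n. \<forall>y\<in>gadget_vertices n. adj E x y \<longleftrightarrow> adj E' (f x) (f y))"

lemma gadget_iso_in: "gadget_iso n E E' f \<Longrightarrow> x \<in> gadget_vertices n \<Longrightarrow> f x \<in> gadget_vertices n"
  by (auto simp: gadget_iso_def bij_betw_def)

lemma gadget_iso_adj:
  "gadget_iso n E E' f \<Longrightarrow> x \<in> gadget_vertices n \<Longrightarrow> y \<in> gadget_vertices n \<Longrightarrow>
    adj E' (f x) (f y) \<longleftrightarrow> adj E x y"
  by (auto simp: gadget_iso_def)

lemma gadget_iso_surj:
  "gadget_iso n E E' f \<Longrightarrow> y \<in> gadget_vertices n \<Longrightarrow> \<exists>x\<in>gadget_vertices n. f x = y"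
  unfolding gadget_iso_def bij_betw_def by (metis imageE)

lemma gadget_iso_inj:
  "gadget_iso n E E' f \<Longrightarrow> x \<in> gadget_vertices n \<Longrightarrow> y \<in> gadget_vertices n \<Longrightarrow> f x = f y \<longleftrightarrow> x = y"
  by (auto simp: gadget_iso_def bij_betw_def inj_on_def)

lemma gadget_iso_inv:
  assumes "gadget_iso n E E' f"
  shows "gadget_iso n E' E (inv_into (gadget_vertices n) f)"
proof -
  have f: "bij_betw f (gadget_vertices n) (gadget_vertices n)"
    using assms by (simp add: gadget_iso_def)
  have g: "bij_betw (inv_into (gadget_vertices n) f) (gadget_vertices n) (gadget_vertices n)"
    by (rule bij_betw_inv_into[OF f])
  have "adj E' x y \<longleftrightarrow> adj E (inv_into (gadget_vertices n) f x) (inv_into (gadget_vertices n) f y)"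
    if "x \<in> gadget_vertices n" "y \<in> gadget_vertices n" for x y
    using gadget_iso_adj[OF assms bij_betw_apply[OF g that(1)] bij_betw_apply[OF g that(2)]] that
    by (simp add: bij_betw_inv_into_right[OF f])
  with g show ?thesis by (simp add: gadget_iso_def)
qed

lemma gadget_iso_comp:
  "gadget_iso n E E' f \<Longrightarrow> gadget_iso n E' E'' g \<Longrightarrow> gadget_iso n E E'' (g \<circ> f)"
  unfolding gadget_iso_def by (auto intro: bij_betw_trans simp: bij_betw_apply)

lemma degree_gadget_iso:
  assumes "gadget_iso n E E' f" "x \<in> gadget_vertices n"
  shows "vertex_degree n E' (f x) = vertex_degree n E x"
proof -
  have "bij_betw f {y \<in> gadget_vertices n. adj E x y} {y \<in> gadget_vertices n. adj E' (f x) y}"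
    using assms unfolding gadget_iso_def bij_betw_def inj_on_def by (auto 0 4)
  then show ?thesis unfolding vertex_degree_def by (simp add: bij_betw_same_card)
qed

definition hub :: "gadget_vertex \<Rightarrow> bool" where
  "hub x \<longleftrightarrow> (\<exists>u. x = Left u \<or> x = Right u)"

lemma hub_simps [simp]: "hub (Left u)" "hub (Right u)" "\<not> hub (LFlag u v)" "\<not> hub (RFlag u v)"
  by (auto simp: hub_def)

text \<open>Hubs have degree \<open>n * n + 2 * n - 1\<close> and flags at most
  \<open>n * n + n + 1\<close>; the former is larger from \<open>n = 3\<close> on.\<close>

lemma hub_iff_degree:
  assumes "3 \<le> n" "x \<in> gadget_vertices n"
  shows "hub x \<longleftrightarrow> n * n + n + 1 < vertex_degree n E x"
  using assms by (cases x) (auto simp: vertex_degree_simps)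

lemma hub_gadget_iso:
  "3 \<le> n \<Longrightarrow> gadget_iso n E E' f \<Longrightarrow> x \<in> gadget_vertices n \<Longrightarrow> hub (f x) \<longleftrightarrow> hub x"
  using hub_iff_degree[of n "f x" E'] hub_iff_degree[of n x E]
  by (simp add: degree_gadget_iso gadget_iso_in)

text \<open>A hub adjacent to a given hub is on the opposite side, so two hubs can have such a
  common neighbour only if they are on the same side.\<close>

definition same_side :: "nat \<Rightarrow> (nat \<Rightarrow> nat \<Rightarrow> bool) \<Rightarrow> gadget_vertex \<Rightarrow> gadget_vertex \<Rightarrow> bool" where
  "same_side n E x y \<longleftrightarrow> (\<exists>z\<in>gadget_vertices n. hub z \<and> adj E x z \<and> adj E y z)"

lemma same_side_Left_Right [simp]: "\<not> same_side n E (Left u) (Right v)"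
  by (auto simp: same_side_def hub_def)

text \<open>A third index \<open>w\<close> yields the common neighbour
  \<open>Right w\<close>.\<close>

lemma same_side_Left_Left:
  assumes "3 \<le> n" shows "same_side n E (Left u) (Left v)"
proof -
  have "card {u, v} < card {..<n}" using assms card_insert_le_m1[of 2 "{v}" u] by simp
  then have "\<not> {..<n} \<subseteq> {u, v}" by (meson card_mono finite.emptyI finite.insertI leD)
  then obtain w where "w < n" "w \<noteq> u" "w \<noteq> v" by blast
  then show ?thesis unfolding same_side_def by (intro bexI[of _ "Right w"]) auto
qed

lemma same_side_gadget_iso:
  assumes "3 \<le> n" "gadget_iso n E E' f" "x \<in> gadget_vertices n" "y \<in> gadget_vertices n" "same_side n E x y"
  shows "same_side n E' (f x) (f y)"
proof -
  obtain z where "z \<in> gadget_vertices n" "hub z" "adj E x z" "adj E y z"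
    using assms(5) by (auto simp: same_side_def)
  then show ?thesis
    unfolding same_side_def using assms
    by (intro bexI[of _ "f z"]) (auto simp: gadget_iso_adj gadget_iso_in hub_gadget_iso)
qed

text \<open>The images of \<open>Left w\<close> and \<open>Left u\<close> are hubs with a common hub
  neighbour, so both are on the left if one is.\<close>

lemma gadget_iso_Left:
  assumes n: "3 \<le> n" and f: "gadget_iso n E E' f" and "f (Left w) = Left w'" "w < n" "u < n"
  obtains a where "a < n" "f (Left u) = Left a"
proof -
  have "hub (f (Left u))" using n f assms(5) by (simp add: hub_gadget_iso)
  moreover have "same_side n E' (f (Left w)) (f (Left u))"
    using assms by (intro same_side_gadget_iso[OF n f] same_side_Left_Left) auto
  ultimately show ?thesis
    using that gadget_iso_in[OF f, of "Left u"] assms by (auto simp: hub_def)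
qed

text \<open>The same-side argument for the inverse of \<open>f\<close> keeps
  \<open>f (Right u)\<close> off the left. It is then a right vertex not adjacent to
  \<open>Left a\<close>, and \<open>Right a\<close> is the only one.\<close>

lemma gadget_iso_Right:
  assumes n: "3 \<le> n" and f: "gadget_iso n E E' f" and w: "f (Left w) = Left w'" "w < n" and "u < n"
    and a: "f (Left u) = Left a"
  shows "f (Right u) = Right a"
proof -
  have hub: "hub (f (Right u))" using n f assms(5) by (simp add: hub_gadget_iso)
  have "f (Right u) \<noteq> Left b" for b
  proof
    assume b: "f (Right u) = Left b"
    let ?g = "inv_into (gadget_vertices n) f"
    have "same_side n E (?g (Left a)) (?g (Left b))"
      using gadget_iso_in[OF f, of "Left u"] gadget_iso_in[OF f, of "Right u"] assms(5) a b
      by (intro same_side_gadget_iso[OF n gadget_iso_inv[OF f]] same_side_Left_Left n) auto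
    moreover have "?g (Left a) = Left u" "?g (Left b) = Right u"
      using f assms(5) a b unfolding gadget_iso_def bij_betw_def
      by (metis in_gadget_vertices(1) inv_into_f_f, metis in_gadget_vertices(2) inv_into_f_f)
    ultimately show False by simp
  qed
  moreover have "\<not> adj E' (f (Left u)) (f (Right u))"
    using f assms(5) by (simp add: gadget_iso_adj)
  ultimately show ?thesis using hub a by (auto simp: hub_def)
qed

text \<open>An edge is recorded by two non-adjacent flags. Once their images are known to be a left
  and a right flag, non-adjacency forces equal coordinates and an edge there; the neighbours
  \<open>Left a\<close> and \<open>Right b\<close> identify these coordinates.\<close>

lemma gadget_iso_edge:
  assumes n: "3 \<le> n" and f: "gadget_iso n E E' f" and uv: "u < n" "v < n"
    and a: "f (Left u) = Left a" and b: "f (Left v) = Left b" and "E u v"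
  shows "E' a b"
proof -
  \<comment> \<open>A left flag is adjacent to all right vertices but a right flag to only one, so
    all right vertices would have the same image.\<close>
  have not_RFlag: "f (LFlag u v) \<noteq> RFlag c d" for c d
  proof
    assume cd: "f (LFlag u v) = RFlag c d"
    have "b' = d" if "w < n" "f (Right w) = Right b'" for w b'
      using gadget_iso_adj[OF f, of "LFlag u v" "Right w"] that uv cd by simp
    then have "f (Right w) = Right d" if "w < n" for w
      using gadget_iso_Left[OF n f a uv(1) that] gadget_iso_Right[OF n f a uv(1) that] that by metis
    then show False using gadget_iso_inj[OF f, of "Right 0" "Right 1"] n by simp
  qed
  have not_LFlag: "f (RFlag u v) \<noteq> LFlag c d" for c d
  proof
    assume cd: "f (RFlag u v) = LFlag c d"
    have "b' = c" if "w < n" "f (Left w) = Left b'" for w b'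
      using gadget_iso_adj[OF f, of "RFlag u v" "Left w"] that uv cd by simp
    then have "f (Left w) = Left c" if "w < n" for w
      using gadget_iso_Left[OF n f a uv(1) that] that by metis
    then show False using gadget_iso_inj[OF f, of "Left 0" "Left 1"] n by simp
  qed
  have "\<not> hub (f (LFlag u v))" "\<not> hub (f (RFlag u v))" using n f uv by (simp_all add: hub_gadget_iso)
  then obtain c d c' d' where cd: "f (LFlag u v) = LFlag c d" "f (RFlag u v) = RFlag c' d'"
    using not_LFlag not_RFlag by (metis gadget_vertex.exhaust hub_simps(1,2))
  have "\<not> adj E' (f (LFlag u v)) (f (RFlag u v))"
    using f uv assms(7) by (simp add: gadget_iso_adj)
  moreover have "adj E' (f (Left u)) (f (LFlag u v))" "adj E' (f (Right v)) (f (RFlag u v))"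
    using f uv by (simp_all add: gadget_iso_adj)
  moreover have "f (Right v) = Right b" by (rule gadget_iso_Right[OF n f a uv(1,2) b])
  ultimately show ?thesis using cd a by auto
qed

text \<open>The coordinates of a flag are exchanged because left flags hang at their first and right
  flags at their second coordinate.\<close>

fun swap :: "gadget_vertex \<Rightarrow> gadget_vertex" where
  "swap (Left u) = Right u"
| "swap (Right u) = Left u"
| "swap (LFlag u v) = RFlag v u"
| "swap (RFlag u v) = LFlag v u"

lemma swap_swap [simp]: "swap (swap x) = x"
  by (cases x) auto

lemma gadget_iso_swap:
  assumes "\<And>u v. E u v \<longleftrightarrow> E v u"
  shows "gadget_iso n E E swap"
proof -
  have *: "swap x \<in> gadget_vertices n" if "x \<in> gadget_vertices n" for x
    using that by (cases x) auto
  have "adj E x y \<longleftrightarrow> adj E (swap x) (swap y)" for x y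
    using assms by (cases x; cases y) auto
  moreover have "bij_betw swap (gadget_vertices n) (gadget_vertices n)"
    by (rule bij_betw_byWitness[where f' = swap]) (auto intro: *)
  ultimately show ?thesis by (simp add: gadget_iso_def)
qed

lemma edge_permutation_of_gadget_iso_Left:
  assumes n: "3 \<le> n" and f: "gadget_iso n E E' f" and w: "f (Left w) = Left w'" "w < n"
  shows "\<exists>s. bij_betw s {..<n} {..<n} \<and> (\<forall>u<n. \<forall>v<n. E u v \<longleftrightarrow> E' (s u) (s v))"
proof -
  have "\<exists>a. a < n \<and> f (Left u) = Left a" if "u < n" for u
    using gadget_iso_Left[OF n f w that] by blast
  then have "\<forall>u. \<exists>a. u < n \<longrightarrow> a < n \<and> f (Left u) = Left a" by blast
  then obtain s where "\<forall>u. u < n \<longrightarrow> s u < n \<and> f (Left u) = Left (s u)"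
    by (rule choice[THEN exE])
  then have s: "s u < n \<and> f (Left u) = Left (s u)" if "u < n" for u using that by blast
  let ?g = "inv_into (gadget_vertices n) f"
  have g: "gadget_iso n E' E ?g" by (rule gadget_iso_inv[OF f])
  have g_Left: "?g (Left (s u)) = Left u" if "u < n" for u
  proof -
    have "bij_betw f (gadget_vertices n) (gadget_vertices n)" using f by (simp add: gadget_iso_def)
    from bij_betw_inv_into_left[OF this, of "Left u"] s[OF that] that show ?thesis by simp
  qed
  have "inj_on s {..<n}"
  proof (rule inj_onI)
    fix u v assume uv: "u \<in> {..<n}" "v \<in> {..<n}" and eq: "s u = s v"
    have "Left u = ?g (Left (s u))" using g_Left uv(1) by simp
    also have "\<dots> = Left v" unfolding eq using g_Left uv(2) by simp
    finally show "u = v" by simp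
  qed
  then have "bij_betw s {..<n} {..<n}"
    unfolding bij_betw_def using s by (simp add: endo_inj_surj image_subset_iff)
  moreover have "E u v \<longleftrightarrow> E' (s u) (s v)" if "u < n" "v < n" for u v
  proof
    show "E u v \<Longrightarrow> E' (s u) (s v)"
      using gadget_iso_edge[OF n f that] s[OF that(1)] s[OF that(2)] by simp
    \<comment> \<open>The inverse of \<open>f\<close> takes \<open>Left (s u)\<close> back to
      \<open>Left u\<close>, so edge preservation applies to it as well.\<close>
    show "E' (s u) (s v) \<Longrightarrow> E u v"
      using gadget_iso_edge[OF n g, of "s u" "s v" u v] s[OF that(1)] s[OF that(2)] g_Left that by simp
  qed
  ultimately show ?thesis by (intro exI[of _ s] conjI allI impI)
qed

text \<open>The degree criterion for hubs needs three vertices, so smaller orders are settled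
  directly. In the main case \<open>f\<close> is composed with \<open>swap\<close> if it sends
  \<open>Left 0\<close> to the right.\<close>

lemma edge_permutation_of_gadget_iso:
  assumes f: "gadget_iso n E E' f"
    and sym: "\<And>u v. E u v \<longleftrightarrow> E v u" "\<And>u v. E' u v \<longleftrightarrow> E' v u"
    and irrefl: "\<And>u. \<not> E u u" "\<And>u. \<not> E' u u"
  shows "\<exists>s. bij_betw s {..<n} {..<n} \<and> (\<forall>u<n. \<forall>v<n. E u v \<longleftrightarrow> E' (s u) (s v))"
proof -
  consider "n \<le> 1" | "n = 2" | "3 \<le> n" by linarith
  then show ?thesis
  proof cases
    case 1
    have "E u v \<longleftrightarrow> E' u v" if "u < n" "v < n" for u v
    proof -
      have "u = v" using that 1 by simp
      then show ?thesis using irrefl by simp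
    qed
    then show ?thesis by (intro exI[of _ id]) simp
  next
    case 2
    \<comment> \<open>Here vertices and flags can have the same degree, but only flags of an edge have degree 6.\<close>
    have edge_iff: "D 0 1 \<longleftrightarrow> (\<exists>x\<in>gadget_vertices n. vertex_degree n D x = 6)"
      if "\<And>u v. D u v \<longleftrightarrow> D v u" "\<And>u. \<not> D u u" for D
    proof
      assume "D 0 1"
      then have "vertex_degree n D (LFlag 0 1) = 6" using 2 by (simp add: vertex_degree_simps)
      then show "\<exists>x\<in>gadget_vertices n. vertex_degree n D x = 6"
        using 2 by (intro bexI[of _ "LFlag 0 1"]) simp_all
    next
      assume "\<exists>x\<in>gadget_vertices n. vertex_degree n D x = 6"
      then obtain x where "x \<in> gadget_vertices n" "vertex_degree n D x = 6" by blast
      then have "\<exists>u v. u < 2 \<and> v < 2 \<and> D u v" using 2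
        by (cases x) (auto simp: vertex_degree_simps split: if_splits)
      then obtain u v where "u < 2" "v < 2" "D u v" by blast
      then show "D 0 1" using that(1)[of 0 1] that(2) by (auto simp: less_2_cases_iff)
    qed
    have "(\<exists>x\<in>gadget_vertices n. vertex_degree n E x = 6) \<longleftrightarrow> (\<exists>x\<in>gadget_vertices n. vertex_degree n E' x = 6)"
    proof
      assume "\<exists>x\<in>gadget_vertices n. vertex_degree n E x = 6"
      then obtain x where "x \<in> gadget_vertices n" "vertex_degree n E x = 6" by blast
      then show "\<exists>x\<in>gadget_vertices n. vertex_degree n E' x = 6"
        using gadget_iso_in[OF f] degree_gadget_iso[OF f] by (intro bexI[of _ "f x"]) simp_all
    next
      assume "\<exists>x\<in>gadget_vertices n. vertex_degree n E' x = 6"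
      then obtain x where "f x \<in> gadget_vertices n" "x \<in> gadget_vertices n" "vertex_degree n E' (f x) = 6"
        using gadget_iso_surj[OF f] by blast
      then show "\<exists>x\<in>gadget_vertices n. vertex_degree n E x = 6"
        using degree_gadget_iso[OF f] by auto
    qed
    then have edge: "E 0 1 \<longleftrightarrow> E' 0 1"
      using edge_iff[of E, OF sym(1) irrefl(1)] edge_iff[of E', OF sym(2) irrefl(2)] by simp
    have "E u v \<longleftrightarrow> E' u v" if "u < 2" "v < 2" for u v
      using that edge irrefl sym(1)[of 1 0] sym(2)[of 1 0] by (auto simp: less_2_cases_iff)
    then show ?thesis using 2 by (intro exI[of _ id]) simp
  next
    case 3
    have "hub (f (Left 0))" using hub_gadget_iso[OF 3 f, of "Left 0"] 3 by simp
    then consider w where "f (Left 0) = Left w" | w where "f (Left 0) = Right w" unfolding hub_def by blast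
    then show ?thesis
    proof cases
      case (1 w)
      show ?thesis
        by (rule edge_permutation_of_gadget_iso_Left[OF 3 f 1]) (use 3 in simp)
    next
      case (2 w)
      have "(swap \<circ> f) (Left 0) = Left w" by (simp add: 2)
      then show ?thesis
        by (rule edge_permutation_of_gadget_iso_Left[OF 3 gadget_iso_comp[OF f gadget_iso_swap[OF sym(2)]]])
          (use 3 in simp)
    qed
  qed
qed

fun map_gadget :: "(nat \<Rightarrow> nat) \<Rightarrow> gadget_vertex \<Rightarrow> gadget_vertex" where
  "map_gadget s (Left u) = Left (s u)"
| "map_gadget s (Right u) = Right (s u)"
| "map_gadget s (LFlag u v) = LFlag (s u) (s v)"
| "map_gadget s (RFlag u v) = RFlag (s u) (s v)"

text \<open>The easy direction: a permutation of the vertices acts on all four parts at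
  once.\<close>

lemma gadget_iso_map_gadget:
  assumes s: "bij_betw s {..<n} {..<n}" and E: "\<And>u v. u < n \<Longrightarrow> v < n \<Longrightarrow> E u v \<longleftrightarrow> E' (s u) (s v)"
  shows "gadget_iso n E E' (map_gadget s)"
proof -
  have inj: "s u = s v \<longleftrightarrow> u = v" if "u < n" "v < n" for u v
    using s that by (auto simp: bij_betw_def inj_on_def)
  have range: "s u < n" if "u < n" for u using s that by (auto simp: bij_betw_def)
  have "inj_on (map_gadget s) (gadget_vertices n)"
  proof (rule inj_onI)
    fix x y assume "x \<in> gadget_vertices n" "y \<in> gadget_vertices n" "map_gadget s x = map_gadget s y"
    then show "x = y" by (cases x; cases y) (auto simp: inj)
  qed
  moreover have "map_gadget s x \<in> gadget_vertices n" if "x \<in> gadget_vertices n" for x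
    using that by (cases x) (auto simp: range)
  ultimately have "bij_betw (map_gadget s) (gadget_vertices n) (gadget_vertices n)"
    unfolding bij_betw_def by (intro conjI endo_inj_surj) (auto simp: gadget_vertices_def)
  moreover have "adj E x y \<longleftrightarrow> adj E' (map_gadget s x) (map_gadget s y)"
    if "x \<in> gadget_vertices n" "y \<in> gadget_vertices n" for x y
    using that by (cases x; cases y) (auto simp: inj E)
  ultimately show ?thesis by (simp add: gadget_iso_def)
qed

section \<open>The reduction\<close>

text \<open>Vertices are numbered by their positions in \<open>vertex_list\<close>, since encodings
  are for graphs on an initial segment of the naturals.\<close>

definition gadget_graph :: "nat \<Rightarrow> (nat \<Rightarrow> nat \<Rightarrow> bool) \<Rightarrow> nat sgraph" where
  "gadget_graph n E =
     \<lparr>verts = {..<length (vertex_list n)},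
      edges = {{i, j} | i j. i < length (vertex_list n) \<and> j < length (vertex_list n) \<and>
        adj E (vertex_list n ! i) (vertex_list n ! j)}\<rparr>"

lemma verts_gadget_graph [simp]: "verts (gadget_graph n E) = {..<length (vertex_list n)}"
  by (simp add: gadget_graph_def)

lemma gadget_graph_edge:
  "i < length (vertex_list n) \<Longrightarrow> j < length (vertex_list n) \<Longrightarrow>
    {i, j} \<in> edges (gadget_graph n E) \<longleftrightarrow> adj E (vertex_list n ! i) (vertex_list n ! j)"
  by (auto simp: gadget_graph_def doubleton_eq_iff adj_commute)

lemma standard_gadget_graph: "standard_graph (gadget_graph n E)"
proof -
  have "e \<subseteq> verts (gadget_graph n E) \<and> card e = 2" if e: "e \<in> edges (gadget_graph n E)" for e
  proof -
    obtain i j where "e = {i, j}" "i < length (vertex_list n)" "j < length (vertex_list n)"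
      "adj E (vertex_list n ! i) (vertex_list n ! j)"
      using e by (auto simp: gadget_graph_def)
    moreover from this have "i \<noteq> j" by auto
    ultimately show ?thesis by simp
  qed
  then show ?thesis by (simp add: standard_graph_def simple_graph_def)
qed

lemma encode_gadget_graph: "encode_graph (gadget_graph n E) = gadget_code n E"
proof -
  let ?l = "length (vertex_list n)"
  have row: "map (\<lambda>j. {i, j} \<in> edges (gadget_graph n E)) [0..<?l] = map (adj E (vertex_list n ! i)) (vertex_list n)"
    if "i < ?l" for i
    using that by (intro nth_equalityI) (simp_all add: gadget_graph_edge)
  have "concat (map (\<lambda>i. map (\<lambda>j. {i, j} \<in> edges (gadget_graph n E)) [0..<?l]) [0..<?l]) =
      concat (map (\<lambda>i. map (adj E (vertex_list n ! i)) (vertex_list n)) [0..<?l])"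
    by (intro arg_cong[of _ _ concat] map_cong) (simp_all add: row)
  also have "map (\<lambda>i. map (adj E (vertex_list n ! i)) (vertex_list n)) [0..<?l] =
      map (\<lambda>x. map (adj E x) (vertex_list n)) (vertex_list n)"
    by (intro nth_equalityI) simp_all
  finally show ?thesis by (simp add: encode_graph_def gadget_code_def Let_def)
qed

lemma bij_betw_nth_vertex_list:
  "bij_betw ((!) (vertex_list n)) {..<length (vertex_list n)} (gadget_vertices n)"
  unfolding gadget_vertices_def by (rule bij_betw_nth) (simp_all add: distinct_vertex_list)

lemma length_vertex_list: "length (vertex_list n) = 2 * n + 2 * (n * n)"
  using card_gadget_vertices[of n] distinct_card[OF distinct_vertex_list[of n]]
  by (simp add: gadget_vertices_def)

lemma gadget_graph_iso_iff:
  "gadget_graph n E \<simeq> gadget_graph m E' \<longleftrightarrow> n = m \<and> (\<exists>f. gadget_iso n E E' f)"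
proof
  assume "gadget_graph n E \<simeq> gadget_graph m E'"
  then obtain g where g: "bij_betw g {..<length (vertex_list n)} {..<length (vertex_list m)}"
    and adj: "\<And>i j. i < length (vertex_list n) \<Longrightarrow> j < length (vertex_list n) \<Longrightarrow>
      {i, j} \<in> edges (gadget_graph n E) \<longleftrightarrow> {g i, g j} \<in> edges (gadget_graph m E')"
    by (auto simp: graph_iso_def)
  have "length (vertex_list n) = length (vertex_list m)" using bij_betw_same_card[OF g] by simp
  \<comment> \<open>The number \<open>2 * n + 2 * (n * n)\<close> of new vertices is strictly
    increasing, so it determines \<open>n\<close>.\<close>
  moreover have "length (vertex_list a) < length (vertex_list b)" if "a < b" for a b
    using that mult_strict_mono[of a b a b] unfolding length_vertex_list by (cases b) auto
  ultimately have m: "m = n" using nat_neq_iff by (metis less_irrefl)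
  let ?num = "inv_into {..<length (vertex_list n)} ((!) (vertex_list n))"
  have num: "bij_betw ?num (gadget_vertices n) {..<length (vertex_list n)}"
    by (rule bij_betw_inv_into[OF bij_betw_nth_vertex_list])
  have num_less: "?num x < length (vertex_list n)" "vertex_list n ! ?num x = x" if "x \<in> gadget_vertices n" for x
    using bij_betw_apply[OF num that] bij_betw_inv_into_right[OF bij_betw_nth_vertex_list that] by simp_all
  have g_less: "g i < length (vertex_list n)" if "i < length (vertex_list n)" for i
    using bij_betw_apply[OF g, of i] that m by simp
  have "gadget_iso n E E' (\<lambda>x. vertex_list n ! g (?num x))"
    unfolding gadget_iso_def
  proof (intro conjI ballI)
    show "bij_betw (\<lambda>x. vertex_list n ! g (?num x)) (gadget_vertices n) (gadget_vertices n)"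
      using bij_betw_trans[OF bij_betw_trans[OF num g[unfolded m]] bij_betw_nth_vertex_list]
      by (simp add: comp_def)
    show "adj E x y \<longleftrightarrow> adj E' (vertex_list n ! g (?num x)) (vertex_list n ! g (?num y))"
      if "x \<in> gadget_vertices n" "y \<in> gadget_vertices n" for x y
      using adj[of "?num x" "?num y"] that by (simp add: m gadget_graph_edge num_less g_less)
  qed
  with m show "n = m \<and> (\<exists>f. gadget_iso n E E' f)" by blast
next
  assume "n = m \<and> (\<exists>f. gadget_iso n E E' f)"
  then obtain f where f: "gadget_iso n E E' f" and m: "n = m" by blast
  let ?num = "inv_into {..<length (vertex_list n)} ((!) (vertex_list n))"
  have num: "bij_betw ?num (gadget_vertices n) {..<length (vertex_list n)}"
    by (rule bij_betw_inv_into[OF bij_betw_nth_vertex_list])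
  have bf: "bij_betw f (gadget_vertices n) (gadget_vertices n)" using f by (simp add: gadget_iso_def)
  have num_less: "?num x < length (vertex_list n)" "vertex_list n ! ?num x = x" if "x \<in> gadget_vertices n" for x
    using bij_betw_apply[OF num that] bij_betw_inv_into_right[OF bij_betw_nth_vertex_list that] by simp_all
  have mem: "vertex_list n ! i \<in> gadget_vertices n" if "i < length (vertex_list n)" for i
    using that by (simp add: gadget_vertices_def)
  have "gadget_graph n E \<simeq> gadget_graph n E'"
    unfolding graph_iso_def
  proof (intro exI[of _ "\<lambda>i. ?num (f (vertex_list n ! i))"] conjI ballI)
    show "bij_betw (\<lambda>i. ?num (f (vertex_list n ! i))) (verts (gadget_graph n E)) (verts (gadget_graph n E'))"
      using bij_betw_trans[OF bij_betw_trans[OF bij_betw_nth_vertex_list bf] num]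
      by (simp add: comp_def)
    show "{i, j} \<in> edges (gadget_graph n E) \<longleftrightarrow>
        {?num (f (vertex_list n ! i)), ?num (f (vertex_list n ! j))} \<in> edges (gadget_graph n E')"
      if "i \<in> verts (gadget_graph n E)" "j \<in> verts (gadget_graph n E)" for i j
      using that by (simp add: gadget_graph_edge num_less gadget_iso_in[OF f] gadget_iso_adj[OF f] mem)
  qed
  with m show "gadget_graph n E \<simeq> gadget_graph m E'" by simp
qed

section \<open>Excluding the forbidden induced subgraphs\<close>

lemma contains_induced_gadget_graph:
  assumes "contains_induced (gadget_graph n E) H"
  obtains h where "inj_on h (verts H)"
    and "\<And>x y. x \<in> verts H \<Longrightarrow> y \<in> verts H \<Longrightarrow> {x, y} \<in> edges H \<longleftrightarrow> adj E (h x) (h y)"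
proof -
  obtain S f where S: "S \<subseteq> {..<length (vertex_list n)}" and f: "bij_betw f S (verts H)"
    and adj: "\<And>u v. u \<in> S \<Longrightarrow> v \<in> S \<Longrightarrow> {u, v} \<in> edges (gadget_graph n E) \<longleftrightarrow> {f u, f v} \<in> edges H"
    using assms by (auto simp: contains_induced_def graph_iso_def induced_def)
  \<comment> \<open>The isomorphism is read backwards, from the pattern into the gadget, so that the
    images of named pattern vertices are available.\<close>
  let ?g = "inv_into S f"
  have g: "?g x \<in> S" "f (?g x) = x" if "x \<in> verts H" for x
    using f that by (auto simp: bij_betw_def inv_into_into f_inv_into_f)
  have less: "?g x < length (vertex_list n)" if "x \<in> verts H" for x
    using S g(1)[OF that] by auto
  show thesis
  proof (rule that)
    show "inj_on (\<lambda>x. vertex_list n ! ?g x) (verts H)"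
    proof (rule inj_onI)
      fix x y assume xy: "x \<in> verts H" "y \<in> verts H" "vertex_list n ! ?g x = vertex_list n ! ?g y"
      then have "?g x = ?g y"
        using distinct_vertex_list less by (simp add: nth_eq_iff_index_eq)
      then show "x = y" using g(2) xy(1,2) by metis
    qed
    show "{x, y} \<in> edges H \<longleftrightarrow> adj E (vertex_list n ! ?g x) (vertex_list n ! ?g y)"
      if "x \<in> verts H" "y \<in> verts H" for x y
      using adj[of "?g x" "?g y"] g less that by (simp add: gadget_graph_edge)
  qed
qed

lemma gadget_graph_no_star: "\<not> contains_induced (gadget_graph n E) (sub_star [1, 0, 2, 0])"
proof
  let ?H = "sub_star [1, 0, 2, 0]"
  assume "contains_induced (gadget_graph n E) ?H"
  then obtain h where inj: "inj_on h (verts ?H)"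
    and h: "\<And>x y. x \<in> verts ?H \<Longrightarrow> y \<in> verts ?H \<Longrightarrow> {x, y} \<in> edges ?H \<longleftrightarrow> adj E (h x) (h y)"
    by (rule contains_induced_gadget_graph) blast
  \<comment> \<open>Reversed, the list is \<open>[0, 2, 0, 1]\<close>: two legs of length 1 and one
    of length 3, hence six vertices including the center.\<close>
  let ?vs = "[Center, Leg 1 0 1, Leg 1 1 1, Leg 3 0 1, Leg 3 0 2, Leg 3 0 3]"
  have vs: "set ?vs \<subseteq> verts ?H" by (auto simp: sub_star_def)
  have adj: "adj E (h x) (h y) \<longleftrightarrow> {x, y} \<in> edges ?H" if "x \<in> set ?vs" "y \<in> set ?vs" for x y
    using h that vs by blast
  have edges: "edges ?H = {{Center, Leg i j 1} | i j. 1 \<le> i \<and> i < 4 \<and> j < [0, 2, 0, 1] ! i} \<union>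
      {{Leg i j k, Leg i j (k + 1)} | i j k. i < 4 \<and> j < [0, 2, 0, 1] ! i \<and> 1 \<le> k \<and> k + 1 \<le> i}"
    by (simp add: sub_star_def eval_nat_numeral)
  \<comment> \<open>With the five edges listed explicitly, every adjacency among the six vertices is
    decided by comparing two-element sets.\<close>
  have edges_list: "edges ?H = {{Center, Leg 1 0 1}, {Center, Leg 1 1 1}, {Center, Leg 3 0 1},
      {Leg 3 0 1, Leg 3 0 2}, {Leg 3 0 2, Leg 3 0 3}}" (is "_ = ?R")
  proof
    show "edges ?H \<subseteq> ?R"
    proof
      fix e assume "e \<in> edges ?H"
      then consider i j where "e = {Center, Leg i j 1}" "1 \<le> i" "i < 4" "j < [0, 2, 0, 1] ! i"
        | i j k where "e = {Leg i j k, Leg i j (k + 1)}" "i < 4" "j < [0, 2, 0, 1] ! i" "1 \<le> k" "k + 1 \<le> i"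
        unfolding edges by blast
      then show "e \<in> ?R"
      proof cases
        case (1 i j)
        then have "i = 1 \<or> i = 2 \<or> i = 3" by linarith
        then have "i = 1 \<and> (j = 0 \<or> j = 1) \<or> i = 3 \<and> j = 0" using 1(4) by auto
        then show ?thesis
          unfolding 1(1) by (elim disjE conjE) (simp_all only: insert_iff simp_thms)
      next
        case (2 i j k)
        then have "i = 2 \<or> i = 3" by linarith
        then have "i = 3 \<and> j = 0" using 2(3) by auto
        moreover from this have "k = 1 \<or> k = 2" using 2(4,5) by linarith
        ultimately have "e = {Leg 3 0 1, Leg 3 0 (1 + 1)} \<or> e = {Leg 3 0 2, Leg 3 0 (2 + 1)}"
          unfolding 2(1) by (elim disjE conjE) (simp_all only: simp_thms)
        then show ?thesis by (elim disjE) (simp_all add: eval_nat_numeral)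
      qed
    qed
    have "{Center, Leg i j 1} \<in> edges ?H" if "1 \<le> i" "i < 4" "j < [0, 2, 0, 1] ! i" for i j
      unfolding edges using that by blast
    from this[of 1 0] this[of 1 1] this[of 3 0]
    have "{{Center, Leg 1 0 1}, {Center, Leg 1 1 1}, {Center, Leg 3 0 1}} \<subseteq> edges ?H" by simp
    moreover have "{Leg i j k, Leg i j (k + 1)} \<in> edges ?H"
      if "i < 4" "j < [0, 2, 0, 1] ! i" "1 \<le> k" "k + 1 \<le> i" for i j k
      unfolding edges using that by blast
    from this[of 3 0 1] this[of 3 0 2]
    have "{{Leg 3 0 1, Leg 3 0 2}, {Leg 3 0 2, Leg 3 0 3}} \<subseteq> edges ?H"
      by (simp add: eval_nat_numeral)
    ultimately show "?R \<subseteq> edges ?H" by blast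
  qed
  have "distinct (map h ?vs)"
    unfolding distinct_map using inj_on_subset[OF inj vs] by simp
  then have distinct: "distinct [h Center, h (Leg 1 0 1), h (Leg 1 1 1), h (Leg 3 0 1), h (Leg 3 0 2), h (Leg 3 0 3)]"
    by (simp only: list.map)
  show False
    by (rule no_star[OF _ _ _ _ _ _ _ _ _ _ _ _ _ _ _ distinct, of E])
      (simp_all add: adj edges_list doubleton_eq_iff del: One_nat_def)
qed

fun part :: "gadget_vertex \<Rightarrow> nat" where
  "part (Left u) = 0"
| "part (Right u) = 1"
| "part (LFlag u v) = 2"
| "part (RFlag u v) = 3"

lemma adj_part: "adj E x y \<Longrightarrow> part x \<noteq> part y"
  by (cases x; cases y) auto

text \<open>Pigeonhole: vertices of a clique lie in different parts, and there are only four
  parts.\<close>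

lemma gadget_graph_no_K5: "\<not> contains_induced (gadget_graph n E) (complete_graph 5)"
proof
  assume "contains_induced (gadget_graph n E) (complete_graph 5)"
  then obtain h where h: "\<And>x y. x \<in> verts (complete_graph 5) \<Longrightarrow> y \<in> verts (complete_graph 5) \<Longrightarrow>
      {x, y} \<in> edges (complete_graph 5) \<longleftrightarrow> adj E (h x) (h y)"
    by (rule contains_induced_gadget_graph) blast
  have "inj_on (part \<circ> h) {..<5}"
  proof (rule inj_onI)
    fix x y :: nat assume xy: "x \<in> {..<5}" "y \<in> {..<5}" "(part \<circ> h) x = (part \<circ> h) y"
    then have "\<not> adj E (h x) (h y)" using adj_part by force
    then show "x = y" using h[of x y] xy(1,2) by (auto simp: complete_graph_def card_2_iff)
  qed
  moreover have "part x < 4" for x by (cases x) auto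
  then have "(part \<circ> h) ` {..<5} \<subseteq> {..<4}" by auto
  ultimately show False using card_inj_on_le[of "part \<circ> h" "{..<5}" "{..<4}"] by simp
qed

lemma gadget_graph_Free: "gadget_graph n E \<in> Free (sub_star [1, 0, 2, 0]) (complete_graph 5)"
  using standard_gadget_graph[of n E] gadget_graph_no_star gadget_graph_no_K5
  by (simp add: Free_def standard_graph_def)

section \<open>Correctness of the reduction on encoded pairs\<close>

definition gadget :: "nat sgraph \<Rightarrow> nat sgraph" where
  "gadget K = gadget_graph (card (verts K)) (adjacent K)"

lemma gadget_iso_iff:
  assumes K: "standard_graph K" and L: "standard_graph L"
  shows "gadget K \<simeq> gadget L \<longleftrightarrow> K \<simeq> L"
proof -
  let ?k = "card (verts K)" and ?l = "card (verts L)"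
  have verts: "verts K = {..<?k}" "verts L = {..<?l}" using K L by (auto simp: standard_graph_def)
  have sym: "adjacent M u v \<longleftrightarrow> adjacent M v u" for M u v
    by (simp add: adjacent_def insert_commute)
  have irrefl: "\<not> adjacent M u u" if "standard_graph M" for M u
    using that by (force simp: adjacent_def standard_graph_def simple_graph_def)
  show ?thesis
  proof
    assume "gadget K \<simeq> gadget L"
    then obtain f where l: "?k = ?l" and "gadget_iso ?k (adjacent K) (adjacent L) f"
      unfolding gadget_def gadget_graph_iso_iff by blast
    then obtain s where "bij_betw s {..<?k} {..<?k}"
      "\<forall>u<?k. \<forall>v<?k. adjacent K u v \<longleftrightarrow> adjacent L (s u) (s v)"
      using edge_permutation_of_gadget_iso sym irrefl[OF K] irrefl[OF L] by blast
    then have "bij_betw s (verts K) (verts L)"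
      and "\<forall>u\<in>verts K. \<forall>v\<in>verts K. {u, v} \<in> edges K \<longleftrightarrow> {s u, s v} \<in> edges L"
      using verts l unfolding adjacent_def by auto
    then show "K \<simeq> L" unfolding graph_iso_def by blast
  next
    assume "K \<simeq> L"
    then obtain s where s: "bij_betw s (verts K) (verts L)"
      and e: "\<forall>u\<in>verts K. \<forall>v\<in>verts K. {u, v} \<in> edges K \<longleftrightarrow> {s u, s v} \<in> edges L"
      by (auto simp: graph_iso_def)
    have l: "?k = ?l" using bij_betw_same_card[OF s] .
    have "gadget_iso ?k (adjacent K) (adjacent L) (map_gadget s)"
    proof (rule gadget_iso_map_gadget)
      show "bij_betw s {..<?k} {..<?k}" using s verts l by metis
      show "adjacent K u v \<longleftrightarrow> adjacent L (s u) (s v)" if "u < ?k" "v < ?k" for u v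
        using e that verts(1) unfolding adjacent_def by blast
    qed
    then show "gadget K \<simeq> gadget L" unfolding gadget_def gadget_graph_iso_iff using l by blast
  qed
qed

lemma gadget_pair_code_eq: "gadget_pair_code K L = encode_graph (gadget K) @ encode_graph (gadget L)"
  by (simp add: gadget_pair_code_def gadget_def encode_gadget_graph)

text \<open>Membership only provides some decoding of the string; by unique decodability it is the
  given pair.\<close>

lemma pair_in_yes_iff:
  assumes "standard_graph K" "standard_graph L" "K \<in> C" "L \<in> C"
  shows "encode_graph K @ encode_graph L \<in> yes_instances (GI_on C) \<longleftrightarrow> K \<simeq> L"
proof
  assume "encode_graph K @ encode_graph L \<in> yes_instances (GI_on C)"
  then obtain K' L' where "standard_graph K'" "standard_graph L'" "K' \<simeq> L'"
    and "encode_graph K @ encode_graph L = encode_graph K' @ encode_graph L'"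
    by (auto simp: GI_on_def)
  moreover from this have "K = K'" and "encode_graph L = encode_graph L'"
    using encode_graph_append_inject assms(1) by blast+
  moreover from this have "L = L'"
    using encode_graph_append_inject[of L L' "[]" "[]"] assms(2) calculation(2) by simp
  ultimately show "K \<simeq> L" by simp
qed (use assms in \<open>auto simp: GI_on_def\<close>)

text \<open>Whether two graphs are isomorphic does not depend on the class, so the string is passed
  on unchanged.\<close>

lemma GI_on_mono_reducible:
  assumes "C \<subseteq> D"
  shows "GI_on C \<le>\<^sub>p GI_on D"
  unfolding poly_reducible_def
proof (intro exI[of _ "\<lambda>x. x"] conjI ballI polytime_id)
  fix x assume "x \<in> instances (GI_on C)"
  then obtain K L where x: "x = encode_graph K @ encode_graph L"
    and KL: "standard_graph K" "standard_graph L" "K \<in> C" "L \<in> C"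
    by (auto simp: GI_on_def)
  with assms show "x \<in> instances (GI_on D)" by (auto simp: GI_on_def)
  show "x \<in> yes_instances (GI_on C) \<longleftrightarrow> x \<in> yes_instances (GI_on D)"
    using pair_in_yes_iff[OF KL] pair_in_yes_iff[OF KL(1,2), of D] KL assms unfolding x by blast
qed

lemma GI_reducible_to_gadgets:
  assumes "\<And>K. gadget K \<in> C"
  shows "GI_on D \<le>\<^sub>p GI_on C"
proof -
  \<comment> \<open>The reduction is a function on strings, so a pair of graphs is chosen for each
    instance; other strings get an arbitrary pair.\<close>
  define decode where "decode x = (SOME (K, L). standard_graph K \<and> standard_graph L \<and> K \<in> D \<and> L \<in> D \<and>
    x = encode_graph K @ encode_graph L)" for x
  have decode: "\<exists>K L. decode x = (K, L) \<and> standard_graph K \<and> standard_graph L \<and> K \<in> D \<and> L \<in> D \<and>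
    x = encode_graph K @ encode_graph L" if "x \<in> instances (GI_on D)" for x
  proof -
    have "\<exists>p. case p of (K, L) \<Rightarrow> standard_graph K \<and> standard_graph L \<and> K \<in> D \<and> L \<in> D \<and>
        x = encode_graph K @ encode_graph L"
      using that by (auto simp: GI_on_def)
    from someI_ex[OF this] show ?thesis
      unfolding decode_def[symmetric] by (cases "decode x") auto
  qed
  define f where "f x = (case decode x of (K, L) \<Rightarrow> gadget_pair_code K L)" for x
  show ?thesis
    unfolding poly_reducible_def
  proof (intro exI[of _ f] conjI ballI)
    show "polytime_on (instances (GI_on D)) f"
      by (rule polytime_gadget_pair) (use decode in \<open>fastforce simp: f_def\<close>)
  next
    fix x assume "x \<in> instances (GI_on D)"
    then obtain K L where KL: "decode x = (K, L)" "standard_graph K" "standard_graph L" "K \<in> D" "L \<in> D"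
      and x: "x = encode_graph K @ encode_graph L"
      using decode by blast
    have std: "standard_graph (gadget M)" for M by (simp add: gadget_def standard_gadget_graph)
    have fx: "f x = encode_graph (gadget K) @ encode_graph (gadget L)"
      by (simp add: f_def KL(1) gadget_pair_code_eq)
    then show "f x \<in> instances (GI_on C)" using assms std by (auto simp: GI_on_def)
    show "x \<in> yes_instances (GI_on D) \<longleftrightarrow> f x \<in> yes_instances (GI_on C)"
      unfolding fx using pair_in_yes_iff[OF KL(2-5)] pair_in_yes_iff[OF std std assms assms]
        gadget_iso_iff[OF KL(2,3)] by (simp add: x)
  qed
qed

theorem theorem6: "isomorphism_complete (Free (sub_star [1, 0, 2, 0]) (complete_graph 5))"
  unfolding isomorphism_complete_def poly_equivalent_def
proof
  show "GI_on (Free (sub_star [1, 0, 2, 0]) (complete_graph 5)) \<le>\<^sub>p GI_on {G. simple_graph G}"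
    by (rule GI_on_mono_reducible) (auto simp: Free_def)
  show "GI_on {G. simple_graph G} \<le>\<^sub>p GI_on (Free (sub_star [1, 0, 2, 0]) (complete_graph 5))"
    by (rule GI_reducible_to_gadgets) (unfold gadget_def, rule gadget_graph_Free)
qed

end
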